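(* Let $a>0$ and let $\Sigma\subset\mathbb C$ be a local maximizer of $\lambda_{1,\varphi}$ under the constraint of having Lebesgue measure $a$. Then $\Sigma$ is a disk up to translation and null sets: there exists $a_0\in\mathbb C$ such that $\Sigma$ coincides, up to a Lebesgue-null set, with $D_R+a_0$, where $D_R=\{|z|<R\}$ and $R=\sqrt{a/\pi}$.
   Context: Identify $\mathbb C$ with $\mathbb R^2$. Let $\varphi(t)=2^{1/4}e^{-\pi t^2}$ on $\mathbb R$ and $V_\varphi f(x,\omega)=\int_{\mathbb R}f(t)\overline{\varphi(t-x)}e^{-2\pi i t\omega}\,dt$ for $f\in L^2(\mathbb R)$. For measurable $\Omega\subset\mathbb C$ of finite measure, $$\lambda_{1,\varphi}(\Omega):=\sup_{\|f\|_{L^2(\mathbb R)}=1}\int_\Omega|V_\varphi f(z)|^2\,dA(z).$$ $\mathcal M_a$ denotes the measurable subsets of $\mathbb C$ of Lebesgue measure $a$, modulo null sets. For measurable sets $\Omega_1,\Omega_2$ of finite measure put $d_w(\Omega_1,\Omega_2)=\int_{\Omega_1\triangle\Omega_2}e^{-\pi|z|^2}\,dA(z)$. A set $\Omega\in\mathcal M_a$ is a local maximizer for $\lambda_{1,\varphi}$ under the measure constraint if there exists $\delta_0>0$ such that $\lambda_{1,\varphi}(\Omega)\ge\lambda_{1,\varphi}(E)$ for every $E\in\mathcal M_a$ with $d_w(\Omega,E)<\delta_0$. *)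

theory Defs
  imports "HOL-Analysis.Analysis"
begin

definition gauss_window :: "real \<Rightarrow> complex" where
  "gauss_window t = complex_of_real (2 powr (1/4) * exp (- pi * t\<^sup>2))"

(* L^2(R) is represented by functions rather than classes; everything below depends only on
   the almost-everywhere class of f. *)
definition L2 :: "(real \<Rightarrow> complex) set" where
  "L2 = {f. f \<in> borel_measurable lebesgue \<and> integrable lebesgue (\<lambda>t. (cmod (f t))\<^sup>2)}"

definition L2_norm :: "(real \<Rightarrow> complex) \<Rightarrow> real" where
  "L2_norm f = sqrt (LINT t|lebesgue. (cmod (f t))\<^sup>2)"

definition stft :: "(real \<Rightarrow> complex) \<Rightarrow> (real \<Rightarrow> complex) \<Rightarrow> real \<Rightarrow> real \<Rightarrow> complex" where
  "stft g f x \<omega> =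
     (LINT t|lebesgue. f t * cnj (g (t - x)) * exp (- 2 * of_real pi * \<i> * of_real t * of_real \<omega>))"

(* For g in L2 and \<Omega> of finite measure, Cauchy-Schwarz gives
   |stft g f| \<le> L2_norm f * L2_norm g, so the real supremum below is over a nonempty set
   that is bounded above. *)
definition lambda1 :: "(real \<Rightarrow> complex) \<Rightarrow> complex set \<Rightarrow> real" where
  "lambda1 g \<Omega> =
     (SUP f \<in> {f \<in> L2. L2_norm f = 1}. LINT z:\<Omega>|lebesgue. (cmod (stft g f (Re z) (Im z)))\<^sup>2)"

(* Sets, not classes modulo null sets: lambda1 and d_w do not see null sets. *)
definition sets_of_measure :: "real \<Rightarrow> complex set set" where
  "sets_of_measure a = {\<Omega> \<in> sets lebesgue. emeasure lebesgue \<Omega> = ennreal a}"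

definition d_w :: "complex set \<Rightarrow> complex set \<Rightarrow> real" where
  "d_w \<Omega>\<^sub>1 \<Omega>\<^sub>2 = (LINT z:sym_diff \<Omega>\<^sub>1 \<Omega>\<^sub>2|lebesgue. exp (- pi * (cmod z)\<^sup>2))"

definition local_maximizer :: "real \<Rightarrow> complex set \<Rightarrow> bool" where
  "local_maximizer a \<Omega> \<longleftrightarrow>
     \<Omega> \<in> sets_of_measure a \<and>
     (\<exists>\<delta>\<^sub>0>0. \<forall>E \<in> sets_of_measure a.
        d_w \<Omega> E < \<delta>\<^sub>0 \<longrightarrow> lambda1 gauss_window \<Omega> \<ge> lambda1 gauss_window E)"

end

theory Submission
  imports Defs "HOL-Complex_Analysis.Complex_Analysis" "HOL-Probability.Distributions"
begin

text \<open>
  Up to conjugation and a phase, the transform of \<open>f\<close> at \<open>z\<close> is \<open>F z * exp (- pi * \<bar>z\<bar>\<^sup>2 / 2)\<close>, where \<open>F\<close>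
  is the Bargmann transform of \<open>f\<close>, an entire function. So \<open>lambda1 gauss_window \<Omega>\<close> is the largest mass
  in \<open>\<Omega>\<close> of a density \<open>u = \<bar>F\<bar>\<^sup>2 exp (- pi \<bar>z\<bar>\<^sup>2)\<close> coming from a unit vector, that is, the top
  eigenvalue \<open>l\<close> of a localization operator with kernel \<open>exp (pi z (cnj w))\<close>.

  The proof uses first-order conditions only, but for the whole top eigenspace at once.

  First, let \<open>S\<close> be a local maximizer and let \<open>F\<close> be any extremal function for \<open>S\<close>. Every competitor
  \<open>E\<close> near \<open>S\<close> satisfies \<open>\<integral>\<^sub>E u \<le> lambda1 E \<le> lambda1 S = \<integral>\<^sub>S u\<close>, so exchanging small pieces shows that
  \<open>S\<close> is a superlevel set of \<open>u\<close>: up to null sets, \<open>{u > t} \<subseteq> S \<subseteq> {u \<ge> t}\<close> for some \<open>t > 0\<close>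
  (\<open>local_bathtub\<close>). An extremal function exists by a normal family argument, which also yields its
  eigenvalue equation (\<open>maximizer_exists\<close>). The equation makes \<open>u\<close> vanish at infinity, and level sets
  of \<open>u\<close> are null because \<open>u\<close> is real analytic along lines; so \<open>S\<close> is, up to a null set, the
  bounded open set \<open>U = {u > t}\<close>, on which \<open>F\<close> has no zeros.

  Second, the eigenspace is closed under differentiation (\<open>deriv_eigenfunction\<close>). Differentiating the
  eigenvalue equation in \<open>z\<close> and integrating by parts in \<open>w\<close> leaves a boundary term with
  integrand \<open>F w * exp (- pi \<bar>w\<bar>\<^sup>2) * exp (pi z (cnj w))\<close>. On the boundary \<open>u = t\<close>, so this
  integrand equals \<open>t * exp (pi z (cnj w)) / cnj (F w)\<close>, which extends antiholomorphically to \<open>U\<close>; the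
  boundary term vanishes by Cauchy's theorem.

  Third, the eigenspace is a line. If \<open>G\<close> is a nonzero eigenfunction, then it is the transform of some
  vector (\<open>eigenfunction_is_bargmann\<close>), hence extremal for \<open>S\<close>, hence \<open>S\<close> is also a superlevel set
  of the density of \<open>G\<close> at a positive level, and \<open>G\<close> has no zero in the open set \<open>U\<close>. But
  \<open>G = F' - c F\<close> is an eigenfunction and vanishes at a prescribed point of \<open>U\<close> if \<open>c\<close> is chosen suitably.
  So \<open>G = 0\<close>, i.e. \<open>F' = c F\<close>.

  Therefore \<open>F\<close> is an exponential, \<open>u\<close> is a translated Gaussian, and its superlevel set \<open>U\<close> is a disk.
\<close>

section \<open>Laplace transforms and Gaussian integrals\<close>

text \<open>Differentiation under the integral by dominated convergence. For \<open>\<bar>h\<bar> \<le> 1\<close> the quotients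
  \<open>(exp (h g) - 1) / h\<close> are dominated by \<open>\<bar>g\<bar> exp \<bar>g\<bar> \<le> exp (2 \<bar>g\<bar>)\<close>; hence the integrability condition
  at every exponential rate \<open>r\<close>.\<close>
lemma laplace_has_field_derivative:
  fixes k g :: "'a \<Rightarrow> complex"
  assumes [measurable]: "k \<in> borel_measurable M" "g \<in> borel_measurable M"
    and int: "\<And>r. integrable M (\<lambda>w. cmod (k w) * exp (r * cmod (g w)))"
  shows "((\<lambda>z. \<integral>w. k w * exp (z * g w) \<partial>M) has_field_derivative
           (\<integral>w. k w * g w * exp (z * g w) \<partial>M)) (at z)"
proof -
  let ?f = "\<lambda>z. \<integral>w. k w * exp (z * g w) \<partial>M"
  have intz: "integrable M (\<lambda>w. k w * exp (z * g w))" for z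
  proof (rule Bochner_Integration.integrable_bound[OF int[of "cmod z"]])
    show "AE w in M. cmod (k w * exp (z * g w)) \<le> norm (cmod (k w) * exp (cmod z * cmod (g w)))"
      using norm_exp[of "z * g _"] by (auto simp: norm_mult simp del: norm_exp_eq_Re intro!: mult_left_mono AE_I2)
  qed simp
  have quot: "(?f (z + h) - ?f z) / h = (\<integral>w. k w * exp (z * g w) * ((exp (h * g w) - 1) / h) \<partial>M)" for h
    using intz[of "z + h"] intz[of z]
    by (subst Bochner_Integration.integral_diff[symmetric]; (simp add: ring_distribs)?)
       (simp add: exp_add algebra_simps diff_divide_distrib flip: integral_divide_zero)
  have "((\<lambda>h. (?f (z + h) - ?f z) / h) \<longlongrightarrow> (\<integral>w. k w * g w * exp (z * g w) \<partial>M)) (at 0 within ball 0 1)"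
    unfolding tendsto_at_iff_sequentially quot comp_def
  proof (intro allI impI)
    fix X :: "nat \<Rightarrow> complex" assume X: "\<forall>i. X i \<in> ball 0 1 - {0}" and X0: "X \<longlonglongrightarrow> 0"
    show "(\<lambda>n. \<integral>w. k w * exp (z * g w) * ((exp (X n * g w) - 1) / X n) \<partial>M) \<longlonglongrightarrow>
          (\<integral>w. k w * g w * exp (z * g w) \<partial>M)"
    proof (rule integral_dominated_convergence[where w = "\<lambda>w. cmod (k w) * exp ((cmod z + 2) * cmod (g w))"])
      show "AE w in M. (\<lambda>n. k w * exp (z * g w) * ((exp (X n * g w) - 1) / X n)) \<longlonglongrightarrow> k w * g w * exp (z * g w)"
      proof (rule AE_I2)
        fix w
        have "((\<lambda>h. exp (h * g w)) has_field_derivative (g w)) (at 0)"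
          by (auto intro!: derivative_eq_intros)
        then have "((\<lambda>h. (exp (h * g w) - 1) / h) \<longlongrightarrow> g w) (at 0)"
          by (simp add: has_field_derivative_iff)
        then have "(\<lambda>n. (exp (X n * g w) - 1) / X n) \<longlonglongrightarrow> g w"
          unfolding tendsto_at_iff_sequentially comp_def using X X0 by auto
        then have "(\<lambda>n. k w * exp (z * g w) * ((exp (X n * g w) - 1) / X n)) \<longlonglongrightarrow> k w * exp (z * g w) * g w"
          by (intro tendsto_intros)
        then show "(\<lambda>n. k w * exp (z * g w) * ((exp (X n * g w) - 1) / X n)) \<longlonglongrightarrow> k w * g w * exp (z * g w)"
          by (simp only: mult.assoc mult.commute[of _ "g w"])
      qed
      show "AE w in M. cmod (k w * exp (z * g w) * ((exp (X n * g w) - 1) / X n))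
              \<le> cmod (k w) * exp ((cmod z + 2) * cmod (g w))" for n
      proof (rule AE_I2)
        fix w
        define a where "a = cmod (g w)"
        have Xn: "cmod (X n) \<le> 1" "X n \<noteq> 0" using X by (auto simp: less_imp_le)
        have "cmod (exp (X n * g w) - 1) \<le> exp \<bar>Re (X n * g w)\<bar> * cmod (X n * g w)"
          using Taylor_exp[of "X n * g w" 0] by simp
        also have "\<dots> \<le> exp a * (cmod (X n) * a)"
        proof (rule mult_mono)
          have "\<bar>Re (X n * g w)\<bar> \<le> cmod (X n) * a"
            using abs_Re_le_cmod[of "X n * g w"] by (simp add: norm_mult a_def)
          also have "\<dots> \<le> 1 * a" by (rule mult_right_mono) (use Xn in \<open>auto simp: a_def\<close>)
          finally show "exp \<bar>Re (X n * g w)\<bar> \<le> exp a" by simp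
        qed (auto simp: norm_mult a_def)
        also have "\<dots> \<le> cmod (X n) * (exp a * exp a)"
        proof -
          have "a \<le> exp a" using exp_ge_add_one_self[of a] by linarith
          then show ?thesis by (simp add: mult_left_mono mult.left_commute)
        qed
        finally have q: "cmod ((exp (X n * g w) - 1) / X n) \<le> exp (2 * a)"
          using Xn(2) by (simp add: norm_divide divide_simps mult.commute flip: exp_add)
        have "cmod (exp (z * g w)) \<le> exp (cmod z * a)"
          using norm_exp[of "z * g w"] by (simp add: norm_mult a_def del: norm_exp_eq_Re)
        then have "cmod (exp (z * g w)) * cmod ((exp (X n * g w) - 1) / X n) \<le> exp (cmod z * a) * exp (2 * a)"
          using q by (intro mult_mono) auto
        then have "cmod (k w) * (cmod (exp (z * g w)) * cmod ((exp (X n * g w) - 1) / X n))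
            \<le> cmod (k w) * (exp (cmod z * a) * exp (2 * a))"
          by (rule mult_left_mono) auto
        then show "cmod (k w * exp (z * g w) * ((exp (X n * g w) - 1) / X n))
              \<le> cmod (k w) * exp ((cmod z + 2) * cmod (g w))"
          by (simp only: norm_mult a_def[symmetric] exp_add ring_distribs mult.assoc)
      qed
    qed (use int in auto)
  qed
  then have "((\<lambda>h. (?f (z + h) - ?f z) / h) \<longlongrightarrow> (\<integral>w. k w * g w * exp (z * g w) \<partial>M)) (at 0)"
    by (simp add: at_within_open[of 0 "ball 0 1"])
  then show ?thesis by (simp add: DERIV_def)
qed

lemma laplace_holomorphic:
  fixes k g :: "'a \<Rightarrow> complex"
  assumes "k \<in> borel_measurable M" "g \<in> borel_measurable M"
    and "\<And>r. integrable M (\<lambda>w. cmod (k w) * exp (r * cmod (g w)))"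
  shows "(\<lambda>z. \<integral>w. k w * exp (z * g w) \<partial>M) holomorphic_on A"
  using laplace_has_field_derivative[OF assms] 
  by (meson field_differentiable_at_within field_differentiable_def holomorphic_on_def)

lemma gaussian_shift:
  fixes s :: real
  shows "has_bochner_integral lborel (\<lambda>t. exp (- 2 * pi * t\<^sup>2 + 2 * pi * t * s)) (exp (pi * s\<^sup>2 / 2) / sqrt 2)"
proof -
  define \<sigma> where "\<sigma> = 1 / (2 * sqrt pi)"
  have s: "\<sigma> > 0" "\<sigma>\<^sup>2 = 1 / (4 * pi)" by (auto simp: \<sigma>_def power_divide power_mult_distrib)
  have e: "normal_density (s/2) \<sigma> t * (exp (pi * s\<^sup>2 / 2) / sqrt 2) = exp (- 2 * pi * t\<^sup>2 + 2 * pi * t * s)" for t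
  proof -
    have "sqrt (2 * pi * \<sigma>\<^sup>2) * sqrt 2 = 1" by (simp add: s real_sqrt_divide flip: real_sqrt_mult)
    moreover have "- (t - s/2)\<^sup>2 / (2 * \<sigma>\<^sup>2) + pi * s\<^sup>2 / 2 = - 2 * pi * t\<^sup>2 + 2 * pi * t * s"
      unfolding s(2) by (simp add: power2_eq_square field_simps)
    moreover have "normal_density (s/2) \<sigma> t * (exp (pi * s\<^sup>2 / 2) / sqrt 2)
        = exp (- (t - s/2)\<^sup>2 / (2 * \<sigma>\<^sup>2) + pi * s\<^sup>2 / 2) / (sqrt (2 * pi * \<sigma>\<^sup>2) * sqrt 2)"
      by (simp only: normal_density_def exp_add) simp
    ultimately show ?thesis by simp
  qed
  have "has_bochner_integral lborel (\<lambda>t. normal_density (s/2) \<sigma> t * (exp (pi * s\<^sup>2 / 2) / sqrt 2)) (1 * (exp (pi * s\<^sup>2 / 2) / sqrt 2))"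
    by (intro has_bochner_integral_mult_left) (use s in \<open>auto simp: has_bochner_integral_iff\<close>)
  then show ?thesis by (simp only: e) simp
qed

lemma gaussian_abs_integrable:
  "integrable lborel (\<lambda>t::real. exp (- 2 * pi * t\<^sup>2 + 2 * pi * r * \<bar>t\<bar>))"
proof (rule Bochner_Integration.integrable_bound)
  show "integrable lborel (\<lambda>t. exp (- 2 * pi * t\<^sup>2 + 2 * pi * t * r) + exp (- 2 * pi * t\<^sup>2 + 2 * pi * t * (- r)))"
    using gaussian_shift[of r] gaussian_shift[of "- r"]
    by (intro Bochner_Integration.integrable_add) (auto simp only: has_bochner_integral_iff)
  have "exp (- 2 * pi * t\<^sup>2 + 2 * pi * r * \<bar>t\<bar>)
      \<le> exp (- 2 * pi * t\<^sup>2 + 2 * pi * t * r) + exp (- 2 * pi * t\<^sup>2 + 2 * pi * t * (- r))" for t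
    by (cases "t \<ge> 0") (auto simp: mult_ac)
  then show "AE t in lborel. norm (exp (- 2 * pi * t\<^sup>2 + 2 * pi * r * \<bar>t\<bar>))
      \<le> norm (exp (- 2 * pi * t\<^sup>2 + 2 * pi * t * r) + exp (- 2 * pi * t\<^sup>2 + 2 * pi * t * (- r)))"
    by (intro AE_I2) (simp only: real_norm_def abs_exp_cancel, rule order_trans[OF _ abs_ge_self])
qed measurable

text \<open>Completing the square settles real \<open>s\<close>; both sides are entire in \<open>s\<close>, so the identity theorem settles
  complex \<open>s\<close>.\<close>
lemma gaussian_complex_shift:
  fixes s :: complex
  shows "has_bochner_integral lborel (\<lambda>t. exp (- 2 * of_real pi * of_real t ^ 2 + 2 * of_real pi * of_real t * s))
           (exp (of_real pi * s\<^sup>2 / 2) / of_real (sqrt 2))"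
proof -
  let ?k = "\<lambda>t::real. exp (- 2 * of_real pi * of_real t ^ 2) :: complex"
  let ?g = "\<lambda>t::real. of_real (2 * pi * t) :: complex"
  have eq: "exp (- 2 * of_real pi * of_real t ^ 2 + 2 * of_real pi * of_real t * s) = ?k t * exp (s * ?g t)" for t :: real and s
    by (simp add: mult_ac flip: exp_add)
  have nk: "cmod (?k t) = exp (- 2 * pi * t\<^sup>2)" for t
    by (simp flip: of_real_power)
  have dom: "integrable lborel (\<lambda>t. cmod (?k t) * exp (r * cmod (?g t)))" for r
    using gaussian_abs_integrable[of r] unfolding nk
    by (simp add: mult_ac abs_mult norm_mult flip: exp_add)
  have hol: "(\<lambda>z. (\<integral>t. ?k t * exp (z * ?g t) \<partial>lborel) - exp (of_real pi * z\<^sup>2 / 2) / of_real (sqrt 2)) holomorphic_on UNIV"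
    by (intro holomorphic_intros laplace_holomorphic dom) (auto simp del: of_real_mult)
  have "(\<integral>t. ?k t * exp (s * ?g t) \<partial>lborel) - exp (of_real pi * s\<^sup>2 / 2) / of_real (sqrt 2) = 0"
  proof (rule analytic_continuation[OF hol, of \<real> 0])
    show "0 islimpt (\<real> :: complex set)"
      unfolding islimpt_sequential
    proof (intro exI[of _ "\<lambda>n. of_real (inverse (real (Suc n)))"] conjI allI)
      show "(\<lambda>n. complex_of_real (inverse (real (Suc n)))) \<longlonglongrightarrow> 0"
        using tendsto_of_real[OF LIMSEQ_inverse_real_of_nat, where 'a=complex] by simp
    qed (auto simp del: of_nat_Suc)
    fix z :: complex assume "z \<in> \<real>"
    then obtain x where z: "z = of_real x" by (auto elim: Reals_cases)
    have "(\<integral>t. ?k t * exp (z * ?g t) \<partial>lborel) = (\<integral>t. complex_of_real (exp (- 2 * pi * t\<^sup>2 + 2 * pi * t * x)) \<partial>lborel)"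
      unfolding eq[symmetric] by (simp add: z flip: exp_of_real)
    also have "\<dots> = of_real (exp (pi * x\<^sup>2 / 2) / sqrt 2)"
      using gaussian_shift[of x] by (simp add: has_bochner_integral_iff)
    finally show "(\<integral>t. ?k t * exp (z * ?g t) \<partial>lborel) - exp (of_real pi * z\<^sup>2 / 2) / of_real (sqrt 2) = 0"
      by (simp add: z flip: exp_of_real)
  qed auto
  moreover have "integrable lborel (\<lambda>t. ?k t * exp (s * ?g t))"
  proof (rule Bochner_Integration.integrable_bound[OF dom[of "cmod s"]])
    show "AE t in lborel. cmod (?k t * exp (s * ?g t)) \<le> norm (cmod (?k t) * exp (cmod s * cmod (?g t)))"
      using norm_exp[of "s * ?g _"] by (auto simp: norm_mult simp del: norm_exp_eq_Re intro!: mult_left_mono AE_I2)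
  qed measurable
  ultimately show ?thesis unfolding has_bochner_integral_iff eq by (simp only: right_minus_eq)
qed

section \<open>Coherent states\<close>

text \<open>The time-frequency shift of the Gaussian window by \<open>z\<close>, multiplied by a phase and by
  \<open>exp (pi \<bar>z\<bar>\<^sup>2 / 2)\<close>. With this factor it depends holomorphically on \<open>z\<close>, and the inner products are the
  reproducing kernel \<open>exp (pi z (cnj w))\<close> of the Fock space.\<close>
definition coherent :: "complex \<Rightarrow> real \<Rightarrow> complex" where
  "coherent z t = of_real (2 powr (1/4)) * exp (of_real pi * (2 * of_real t * z - of_real t ^ 2 - z\<^sup>2 / 2))"

lemma coherent_measurable [measurable]: "coherent z \<in> borel_measurable borel"
  unfolding coherent_def[abs_def] by measurable

lemma coherent_inner:
  "has_bochner_integral lborel (\<lambda>t. coherent z t * cnj (coherent w t)) (exp (of_real pi * z * cnj w))"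
proof -
  define c where "c = of_real (sqrt 2) * exp (- of_real pi * (z\<^sup>2 + (cnj w)\<^sup>2) / 2)"
  have "has_bochner_integral lborel
      (\<lambda>t. c * exp (- 2 * of_real pi * of_real t ^ 2 + 2 * of_real pi * of_real t * (z + cnj w)))
      (c * (exp (of_real pi * (z + cnj w)\<^sup>2 / 2) / of_real (sqrt 2)))"
    by (intro has_bochner_integral_mult_right gaussian_complex_shift)
  moreover have "c * exp (- 2 * of_real pi * of_real t ^ 2 + 2 * of_real pi * of_real t * (z + cnj w))
      = coherent z t * cnj (coherent w t)" for t
  proof -
    have "(2 powr (1/4) * 2 powr (1/4) :: real) = sqrt 2"
      by (simp add: powr_half_sqrt flip: powr_add)
    then have 2: "complex_of_real (2 powr (1/4)) * of_real (2 powr (1/4)) = of_real (sqrt 2)"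
      by (metis of_real_mult)
    have "coherent z t * cnj (coherent w t) = (of_real (2 powr (1/4)) * of_real (2 powr (1/4))) *
       (exp (of_real pi * (2 * of_real t * z - of_real t ^ 2 - z\<^sup>2 / 2)) *
        exp (of_real pi * (2 * of_real t * cnj w - of_real t ^ 2 - (cnj w)\<^sup>2 / 2)))"
      by (simp add: coherent_def exp_cnj mult_ac)
    also have "\<dots> = c * exp (- 2 * of_real pi * of_real t ^ 2 + 2 * of_real pi * of_real t * (z + cnj w))"
      unfolding 2 c_def mult.assoc exp_add[symmetric]
      by (intro arg_cong2[where f="(*)"] arg_cong[where f=exp] refl) (simp add: field_simps)
    finally show ?thesis ..
  qed
  moreover have "c * (exp (of_real pi * (z + cnj w)\<^sup>2 / 2) / of_real (sqrt 2)) = exp (of_real pi * z * cnj w)"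
  proof -
    have "c * (exp (of_real pi * (z + cnj w)\<^sup>2 / 2) / of_real (sqrt 2))
      = exp (- of_real pi * (z\<^sup>2 + (cnj w)\<^sup>2) / 2) * exp (of_real pi * (z + cnj w)\<^sup>2 / 2)"
      by (simp add: c_def)
    also have "\<dots> = exp (of_real pi * z * cnj w)"
      unfolding exp_add[symmetric] by (intro arg_cong[where f=exp]) (simp add: power2_eq_square field_simps)
    finally show ?thesis .
  qed
  ultimately show ?thesis by simp
qed

lemma coherent_norm_sq:
  "has_bochner_integral lborel (\<lambda>t. (cmod (coherent z t))\<^sup>2) (exp (pi * (cmod z)\<^sup>2))"
proof -
  have "has_bochner_integral lborel (\<lambda>t. Re (coherent z t * cnj (coherent z t))) (Re (exp (of_real pi * z * cnj z)))"
    by (rule has_bochner_integral_bounded_linear[OF bounded_linear_Re coherent_inner])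
  moreover have "Re (coherent z t * cnj (coherent z t)) = (cmod (coherent z t))\<^sup>2" for t
    unfolding complex_norm_square[symmetric] by (rule Re_complex_of_real)
  moreover have "exp (of_real pi * z * cnj z) = of_real (exp (pi * (cmod z)\<^sup>2))"
    unfolding mult.assoc complex_norm_square[symmetric] of_real_mult[symmetric] by (rule exp_of_real)
  ultimately show ?thesis by (simp only: Re_complex_of_real)
qed

lemma lebesgue_has_bochner_integral:
  fixes f :: "'a::euclidean_space \<Rightarrow> 'b::{banach, second_countable_topology}"
  assumes "has_bochner_integral lborel f x"
  shows "has_bochner_integral lebesgue f x"
proof -
  have "f \<in> borel_measurable lborel" using assms by (auto simp: has_bochner_integral_iff)
  with assms show ?thesis by (simp add: has_bochner_integral_iff integrable_completion integral_completion)
qed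

lemma coherent_L2: "coherent z \<in> L2"
proof -
  have "coherent z \<in> borel_measurable lebesgue" by (rule measurable_completion) simp
  then show ?thesis
    using lebesgue_has_bochner_integral[OF coherent_norm_sq[of z]] unfolding L2_def has_bochner_integral_iff by blast
qed

lemma L2_norm_coherent: "(L2_norm (coherent z))\<^sup>2 = exp (pi * (cmod z)\<^sup>2)"
proof -
  have "(LINT t|lebesgue. (cmod (coherent z t))\<^sup>2) = exp (pi * (cmod z)\<^sup>2)"
    using lebesgue_has_bochner_integral[OF coherent_norm_sq[of z]] unfolding has_bochner_integral_iff by blast
  then show ?thesis unfolding L2_norm_def by simp
qed

section \<open>Square-integrable functions and the Bargmann transform\<close>

lemma L2_measurable: "f \<in> L2 \<Longrightarrow> f \<in> borel_measurable lebesgue"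
  by (simp add: L2_def)

lemma L2_cnj: "f \<in> L2 \<Longrightarrow> (\<lambda>t. cnj (f t)) \<in> L2"
  by (auto simp: L2_def intro: measurable_compose[OF _ borel_measurable_continuous_onI[OF continuous_on_cnj[OF continuous_on_id]]])

lemma L2_norm_cnj: "L2_norm (\<lambda>t. cnj (f t)) = L2_norm f"
  by (simp add: L2_norm_def)

lemma L2_norm_sq: "(L2_norm f)\<^sup>2 = (LINT t|lebesgue. (cmod (f t))\<^sup>2)"
  by (simp add: L2_norm_def)

lemma L2_mult_integrable:
  assumes "f \<in> L2" "g \<in> L2"
  shows "integrable lebesgue (\<lambda>t. f t * g t)"
proof (rule Bochner_Integration.integrable_bound)
  show "integrable lebesgue (\<lambda>t. (cmod (f t))\<^sup>2 + (cmod (g t))\<^sup>2)"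
    using assms by (auto simp: L2_def)
  show "(\<lambda>t. f t * g t) \<in> borel_measurable lebesgue"
    using assms[THEN L2_measurable] by (rule borel_measurable_times)
  have "x * y \<le> x\<^sup>2 + y\<^sup>2" for x y :: real
    using sum_squares_bound[of x y] zero_le_power2[of x] zero_le_power2[of y] by linarith
  then show "AE t in lebesgue. norm (f t * g t) \<le> norm ((cmod (f t))\<^sup>2 + (cmod (g t))\<^sup>2)"
    by (auto simp: norm_mult)
qed

lemma L2_add_scale:
  assumes f: "f \<in> L2" and g: "g \<in> L2"
  shows "(\<lambda>t. f t + s * g t) \<in> L2"
    and "(L2_norm (\<lambda>t. f t + s * g t))\<^sup>2
       = (L2_norm f)\<^sup>2 + 2 * Re (cnj s * (LINT t|lebesgue. f t * cnj (g t))) + (cmod s)\<^sup>2 * (L2_norm g)\<^sup>2"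
proof -
  have expand: "(cmod (f t + s * g t))\<^sup>2 = (cmod (f t))\<^sup>2 + 2 * Re (cnj s * (f t * cnj (g t))) + (cmod s)\<^sup>2 * (cmod (g t))\<^sup>2" for t
    unfolding cmod_power2 by (simp add: power2_eq_square algebra_simps)
  have i: "integrable lebesgue (\<lambda>t. (cmod (f t))\<^sup>2)" "integrable lebesgue (\<lambda>t. (cmod (g t))\<^sup>2)"
    using f g by (auto simp: L2_def)
  have p: "integrable lebesgue (\<lambda>t. cnj s * (f t * cnj (g t)))"
    by (intro integrable_mult_right L2_mult_integrable f L2_cnj g)
  have "integrable lebesgue (\<lambda>t. (cmod (f t + s * g t))\<^sup>2)"
    unfolding expand by (intro Bochner_Integration.integrable_add integrable_mult_right integrable_Re i p)
  then show "(\<lambda>t. f t + s * g t) \<in> L2"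
    using f g by (auto simp: L2_def)
  have "(L2_norm (\<lambda>t. f t + s * g t))\<^sup>2 = (LINT t|lebesgue. (cmod (f t))\<^sup>2) 
      + 2 * (LINT t|lebesgue. Re (cnj s * (f t * cnj (g t)))) + (cmod s)\<^sup>2 * (LINT t|lebesgue. (cmod (g t))\<^sup>2)"
  proof -
    define h where "h t = Re (cnj s * (f t * cnj (g t)))" for t
    have "integrable lebesgue h" unfolding h_def by (rule integrable_Re[OF p])
    then show ?thesis unfolding L2_norm_sq expand h_def[symmetric] using i by simp
  qed
  also have "(LINT t|lebesgue. Re (cnj s * (f t * cnj (g t)))) = Re (cnj s * (LINT t|lebesgue. f t * cnj (g t)))"
    using p L2_mult_integrable[OF f L2_cnj[OF g]] by (subst integral_Re) simp_all
  finally show "(L2_norm (\<lambda>t. f t + s * g t))\<^sup>2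
       = (L2_norm f)\<^sup>2 + 2 * Re (cnj s * (LINT t|lebesgue. f t * cnj (g t))) + (cmod s)\<^sup>2 * (L2_norm g)\<^sup>2"
    unfolding L2_norm_sq .
qed

lemma L2_scale:
  assumes "f \<in> L2"
  shows "(\<lambda>t. s * f t) \<in> L2" "(L2_norm (\<lambda>t. s * f t))\<^sup>2 = (cmod s)\<^sup>2 * (L2_norm f)\<^sup>2"
proof -
  have "(\<lambda>t. 0) \<in> L2" by (simp add: L2_def)
  note this[THEN L2_add_scale(1), OF assms, of s] this[THEN L2_add_scale(2), OF assms, of s]
  then show "(\<lambda>t. s * f t) \<in> L2" "(L2_norm (\<lambda>t. s * f t))\<^sup>2 = (cmod s)\<^sup>2 * (L2_norm f)\<^sup>2"
    by (simp_all add: L2_norm_sq)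
qed

text \<open>The norm of \<open>f - (I / n) g\<close> is nonnegative, where \<open>I\<close> is the inner product and \<open>n\<close> the squared norm of
  \<open>g\<close>.\<close>
lemma L2_Cauchy_Schwarz:
  assumes f: "f \<in> L2" and g: "g \<in> L2" and pos: "L2_norm g \<noteq> 0"
  shows "(cmod (LINT t|lebesgue. f t * cnj (g t)))\<^sup>2 \<le> (L2_norm f)\<^sup>2 * (L2_norm g)\<^sup>2"
proof -
  define I where "I = (LINT t|lebesgue. f t * cnj (g t))"
  define n where "n = (L2_norm g)\<^sup>2"
  have n: "n > 0" using pos by (simp add: n_def)
  have "0 \<le> (L2_norm (\<lambda>t. f t + (- I / of_real n) * g t))\<^sup>2" by simp
  also have "\<dots> = (L2_norm f)\<^sup>2 + 2 * Re (cnj (- I / of_real n) * I) + (cmod (- I / of_real n))\<^sup>2 * n"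
    unfolding L2_add_scale(2)[OF f g] I_def n_def ..
  also have "cnj (- I / of_real n) * I = of_real (- (cmod I)\<^sup>2 / n)"
    using complex_norm_square[of I] by (simp add: mult.commute)
  also have "(cmod (- I / of_real n))\<^sup>2 * n = (cmod I)\<^sup>2 / n"
    using n by (simp add: norm_divide power_divide power2_eq_square)
  finally have "(cmod I)\<^sup>2 / n \<le> (L2_norm f)\<^sup>2" by simp
  then show ?thesis using n unfolding I_def[symmetric] n_def[symmetric] by (simp add: pos_divide_le_eq)
qed

definition bargmann :: "(real \<Rightarrow> complex) \<Rightarrow> complex \<Rightarrow> complex" where
  "bargmann f z = (LINT t|lebesgue. f t * coherent z t)"

text \<open>For a Bargmann transform this is the squared modulus of the windowed transform (\<open>stft_eq_bargmann\<close>).\<close>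
definition husimi :: "(complex \<Rightarrow> complex) \<Rightarrow> complex \<Rightarrow> real" where
  "husimi F z = (cmod (F z))\<^sup>2 * exp (- pi * (cmod z)\<^sup>2)"

lemma husimi_nonneg [simp]: "0 \<le> husimi F z"
  by (simp add: husimi_def)

text \<open>The transform pairs \<open>f\<close> with conjugated time-frequency shifts, whereas \<^const>\<open>bargmann\<close> pairs without
  conjugation in order to be holomorphic; this is why \<open>f\<close> is conjugated.\<close>
lemma stft_eq_bargmann:
  "(cmod (stft gauss_window f (Re z) (Im z)))\<^sup>2 = husimi (bargmann (\<lambda>t. cnj (f t))) z"
proof -
  define c where "c = exp (of_real pi * (\<i> * Re z * Im z - of_real ((cmod z)\<^sup>2) / 2))"
  have "f t * cnj (gauss_window (t - Re z)) * exp (- 2 * of_real pi * \<i> * of_real t * of_real (Im z))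
      = cnj (c * (cnj (f t) * coherent z t))" for t
  proof -
    have "\<i> * of_real x * of_real y - of_real (x\<^sup>2 + y\<^sup>2) / 2
        + (2 * of_real t * (of_real x + \<i> * of_real y) - of_real t ^ 2 - (of_real x + \<i> * of_real y)\<^sup>2 / 2)
        = - of_real ((t - x)\<^sup>2) + 2 * \<i> * of_real t * of_real y" for x y :: real
      by (simp add: power2_eq_square field_simps)
    from this[of "Re z" "Im z"]
    have e: "\<i> * of_real (Re z) * of_real (Im z) - of_real ((cmod z)\<^sup>2) / 2
        + (2 * of_real t * z - of_real t ^ 2 - z\<^sup>2 / 2) = - of_real ((t - Re z)\<^sup>2) + 2 * \<i> * of_real t * of_real (Im z)"
      unfolding complex_eq[symmetric] cmod_power2 .
    have "c * exp (of_real pi * (2 * of_real t * z - of_real t ^ 2 - z\<^sup>2 / 2))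
        = exp (of_real (- pi * (t - Re z)\<^sup>2)) * exp (2 * of_real pi * \<i> * of_real t * of_real (Im z))"
      unfolding c_def exp_add[symmetric] distrib_left[symmetric] e
      by (rule arg_cong[where f=exp]) (simp add: algebra_simps)
    then have "c * coherent z t = gauss_window (t - Re z) * exp (2 * of_real pi * \<i> * of_real t * of_real (Im z))"
      unfolding coherent_def gauss_window_def of_real_mult[of "2 powr (1/4)"] exp_of_real[symmetric]
      by (simp only: mult.left_commute[of c] mult.assoc)
    then have "cnj (c * coherent z t) = cnj (gauss_window (t - Re z)) * exp (- 2 * of_real pi * \<i> * of_real t * of_real (Im z))"
      by (simp add: exp_cnj)
    then show ?thesis by (simp add: mult_ac)
  qed
  then have "stft gauss_window f (Re z) (Im z) = (LINT t|lebesgue. cnj (c * (cnj (f t) * coherent z t)))"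
    unfolding stft_def by (simp only:)
  also have "\<dots> = cnj (c * bargmann (\<lambda>t. cnj (f t)) z)"
    unfolding bargmann_def integral_mult_right_zero[symmetric] Bochner_Integration.integral_cnj[symmetric] ..
  finally have "cmod (stft gauss_window f (Re z) (Im z)) = cmod c * cmod (bargmann (\<lambda>t. cnj (f t)) z)"
    by (simp add: norm_mult)
  moreover have "(cmod c)\<^sup>2 = exp (- pi * (cmod z)\<^sup>2)"
    unfolding c_def norm_exp_eq_Re power2_eq_square exp_add[symmetric]
    by (simp add: algebra_simps)
  ultimately show ?thesis by (simp add: husimi_def power_mult_distrib mult.commute)
qed

lemma bargmann_add_scale:
  assumes "f \<in> L2" "g \<in> L2"
  shows "bargmann (\<lambda>t. f t + s * g t) z = bargmann f z + s * bargmann g z"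
  using L2_mult_integrable[OF assms(1) coherent_L2] L2_mult_integrable[OF assms(2) coherent_L2]
  unfolding bargmann_def by (simp add: ring_distribs mult.assoc)

text \<open>Point evaluation is the inner product with a coherent state, whose norm the weight cancels exactly.\<close>
lemma husimi_bargmann_le:
  assumes "f \<in> L2"
  shows "husimi (bargmann f) z \<le> (L2_norm f)\<^sup>2"
proof -
  have n: "(L2_norm (\<lambda>t. cnj (coherent z t)))\<^sup>2 = exp (pi * (cmod z)\<^sup>2)"
    by (simp add: L2_norm_cnj L2_norm_coherent)
  then have "L2_norm (\<lambda>t. cnj (coherent z t)) \<noteq> 0"
    by (metis exp_not_eq_zero power_zero_numeral)
  from L2_Cauchy_Schwarz[OF assms L2_cnj[OF coherent_L2] this]
  have "(cmod (bargmann f z))\<^sup>2 \<le> (L2_norm f)\<^sup>2 * exp (pi * (cmod z)\<^sup>2)"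
    by (simp add: n bargmann_def)
  then have "husimi (bargmann f) z \<le> (L2_norm f)\<^sup>2 * exp (pi * (cmod z)\<^sup>2) * exp (- pi * (cmod z)\<^sup>2)"
    unfolding husimi_def by (rule mult_right_mono) simp
  then show ?thesis by (simp add: mult.assoc flip: exp_add)
qed

lemma bargmann_holomorphic:
  assumes f: "f \<in> L2"
  shows "bargmann f holomorphic_on A"
proof -
  let ?k = "\<lambda>t::real. f t * of_real (2 powr (1/4) * exp (- pi * t\<^sup>2))"
  let ?g = "\<lambda>t::real. of_real (2 * pi * t) :: complex"
  have [measurable]: "f \<in> borel_measurable lebesgue" by (rule L2_measurable[OF f])
  have m [measurable]: "(\<lambda>t. exp (- 2 * pi * t\<^sup>2 + 2 * pi * r * \<bar>t\<bar>)) \<in> borel_measurable lebesgue" for r :: real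
    by (rule measurable_completion) simp
  have mg [measurable]: "(\<lambda>t. of_real (2 * pi * t) :: complex) \<in> borel_measurable lebesgue"
     by (rule measurable_completion) simp
  have mk [measurable]: "(\<lambda>t. of_real (2 powr (1/4) * exp (- pi * t\<^sup>2)) :: complex) \<in> borel_measurable lebesgue"
     by (rule measurable_completion) simp
  have int: "integrable lebesgue (\<lambda>t. cmod (?k t) * exp (r * cmod (?g t)))" for r
  proof (rule Bochner_Integration.integrable_bound)
    show "integrable lebesgue (\<lambda>t. (cmod (f t))\<^sup>2 + sqrt 2 * exp (- 2 * pi * t\<^sup>2 + 2 * pi * (2 * r) * \<bar>t\<bar>))"
      using f gaussian_abs_integrable[of "2 * r"]
      by (intro Bochner_Integration.integrable_add integrable_mult_right) (auto simp: L2_def integrable_completion)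
    have xy: "x * y \<le> x\<^sup>2 + y\<^sup>2" for x y :: real
      using sum_squares_bound[of x y] zero_le_power2[of x] zero_le_power2[of y] by linarith
    have "cmod (?k t) * exp (r * cmod (?g t)) \<le> (cmod (f t))\<^sup>2 + sqrt 2 * exp (- 2 * pi * t\<^sup>2 + 2 * pi * (2 * r) * \<bar>t\<bar>)" for t
    proof -
      have "cmod (?k t) * exp (r * cmod (?g t)) = cmod (f t) * (2 powr (1/4) * exp (- pi * t\<^sup>2 + r * (2 * pi * \<bar>t\<bar>)))"
        by (simp only: norm_mult norm_of_real abs_mult exp_add) simp
      also have "\<dots> \<le> (cmod (f t))\<^sup>2 + (2 powr (1/4) * exp (- pi * t\<^sup>2 + r * (2 * pi * \<bar>t\<bar>)))\<^sup>2"
        by (rule xy)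
      also have "(2 powr (1/4) * exp (- pi * t\<^sup>2 + r * (2 * pi * \<bar>t\<bar>)))\<^sup>2 = sqrt 2 * exp (- 2 * pi * t\<^sup>2 + 2 * pi * (2 * r) * \<bar>t\<bar>)"
      proof -
        have "(2 powr (1/4))\<^sup>2 = sqrt 2" by (simp add: powr_half_sqrt power2_eq_square flip: powr_add)
        moreover have "(exp (- pi * t\<^sup>2 + r * (2 * pi * \<bar>t\<bar>)))\<^sup>2 = exp (- 2 * pi * t\<^sup>2 + 2 * pi * (2 * r) * \<bar>t\<bar>)"
          unfolding power2_eq_square[of "exp _"] exp_add[symmetric] by (rule arg_cong[where f=exp]) (simp add: algebra_simps)
        ultimately show ?thesis by (simp only: power_mult_distrib)
      qed
      finally show ?thesis .
    qed
    then show "AE t in lebesgue. norm (cmod (?k t) * exp (r * cmod (?g t)))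
        \<le> norm ((cmod (f t))\<^sup>2 + sqrt 2 * exp (- 2 * pi * t\<^sup>2 + 2 * pi * (2 * r) * \<bar>t\<bar>))"
      by (intro AE_I2) (simp only: real_norm_def abs_mult abs_norm_cancel abs_exp_cancel, rule order_trans[OF _ abs_ge_self])
    have "(\<lambda>t. cmod (k t) * exp (r * cmod (g t))) \<in> borel_measurable lebesgue"
      if [measurable]: "k \<in> borel_measurable lebesgue" "g \<in> borel_measurable lebesgue" for k g :: "real \<Rightarrow> complex"
      by measurable
    then show "(\<lambda>t. cmod (?k t) * exp (r * cmod (?g t))) \<in> borel_measurable lebesgue"
      using borel_measurable_times[OF L2_measurable[OF f] mk] mg by blast
  qed
  have "f t * coherent z t = exp (- of_real pi * z\<^sup>2 / 2) * (?k t * exp (z * ?g t))" for z t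
  proof -
    have "exp (of_real pi * (2 * of_real t * z - of_real t ^ 2 - z\<^sup>2 / 2))
        = exp (- of_real pi * z\<^sup>2 / 2) * (exp (of_real (- pi * t\<^sup>2)) * exp (z * ?g t))"
      unfolding exp_add[symmetric] by (rule arg_cong[where f=exp]) (simp add: algebra_simps)
    then show ?thesis
      unfolding coherent_def of_real_mult[of "2 powr (1/4)"] exp_of_real[symmetric]
      by (simp only: mult.left_commute mult.assoc)
  qed
  then have eq: "bargmann f = (\<lambda>z. exp (- of_real pi * z\<^sup>2 / 2) * (LINT t|lebesgue. ?k t * exp (z * ?g t)))"
    unfolding bargmann_def integral_mult_right_zero[symmetric] by (simp only:)
  have "?k \<in> borel_measurable lebesgue" by (rule borel_measurable_times[OF L2_measurable[OF f] mk])
  then have "(\<lambda>z. LINT t|lebesgue. ?k t * exp (z * ?g t)) holomorphic_on A"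
    by (rule laplace_holomorphic[OF _ mg int])
  then show ?thesis unfolding eq by (intro holomorphic_intros) auto
qed

section \<open>The concentration functional in terms of the Bargmann transform\<close>

lemma husimi_continuous:
  assumes "F holomorphic_on UNIV"
  shows "continuous_on UNIV (husimi F)"
  unfolding husimi_def[abs_def]
  by (intro continuous_intros holomorphic_on_imp_continuous_on assms)

lemma bounded_set_integrable:
  fixes u :: "complex \<Rightarrow> 'b::{banach, second_countable_topology}"
  assumes \<Omega>: "\<Omega> \<in> lmeasurable" and u: "u \<in> borel_measurable borel" and bd: "\<And>z. norm (u z) \<le> C"
  shows "set_integrable lebesgue \<Omega> u"
proof -
  have u': "u \<in> borel_measurable lebesgue" by (rule measurable_completion) (use u in simp)
  show ?thesis unfolding set_integrable_def
  proof (rule Bochner_Integration.integrable_bound)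
    show "integrable lebesgue (\<lambda>z. indicator \<Omega> z * C)"
      using \<Omega> by (intro integrable_mult_left integrable_real_indicator) (auto simp: fmeasurable_def)
    show "(\<lambda>z. indicator \<Omega> z *\<^sub>R u z) \<in> borel_measurable lebesgue"
      using \<Omega> u' by (intro borel_measurable_scaleR borel_measurable_indicator) auto
    show "AE z in lebesgue. norm (indicator \<Omega> z *\<^sub>R u z) \<le> norm (indicator \<Omega> z * C)"
      using bd by (intro AE_I2) (auto simp: indicator_def intro: order_trans[OF _ abs_ge_self])
  qed
qed

lemma husimi_set_integrable:
  assumes "\<Omega> \<in> lmeasurable" "F holomorphic_on UNIV" "\<And>z. husimi F z \<le> C"
  shows "set_integrable lebesgue \<Omega> (husimi F)"
  using assms
  by (intro bounded_set_integrable[where C=C] borel_measurable_continuous_onI husimi_continuous) auto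

text \<open>Conjugation permutes the unit sphere, so the supremum can be taken over Bargmann transforms.\<close>
lemma lambda1_gauss_eq:
  "lambda1 gauss_window \<Omega> = (SUP f \<in> {f \<in> L2. L2_norm f = 1}. LINT z:\<Omega>|lebesgue. husimi (bargmann f) z)"
proof -
  have "(\<lambda>f t. cnj (f t)) ` {f \<in> L2. L2_norm f = 1} = {f \<in> L2. L2_norm f = 1}"
  proof (intro equalityI subsetI)
    fix f assume "f \<in> {f \<in> L2. L2_norm f = 1}"
    then show "f \<in> (\<lambda>f t. cnj (f t)) ` {f \<in> L2. L2_norm f = 1}"
      by (intro image_eqI[where x="\<lambda>t. cnj (f t)"]) (auto simp: L2_cnj L2_norm_cnj)
  qed (auto simp: L2_cnj L2_norm_cnj)
  moreover have "(\<lambda>f. LINT z:\<Omega>|lebesgue. husimi (bargmann f) z) ` ((\<lambda>f t. cnj (f t)) ` {f \<in> L2. L2_norm f = 1})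
      = (\<lambda>f. LINT z:\<Omega>|lebesgue. husimi (bargmann (\<lambda>t. cnj (f t))) z) ` {f \<in> L2. L2_norm f = 1}"
    by (simp only: image_image)
  ultimately show ?thesis unfolding lambda1_def stft_eq_bargmann by (simp only:)
qed

lemma husimi_mass_bdd:
  assumes "\<Omega> \<in> lmeasurable"
  shows "bdd_above ((\<lambda>f. LINT z:\<Omega>|lebesgue. husimi (bargmann f) z) ` {f \<in> L2. L2_norm f = 1})"
proof (rule bdd_aboveI2)
  fix f assume f: "f \<in> {f \<in> L2. L2_norm f = 1}"
  then have le: "husimi (bargmann f) z \<le> 1" for z using husimi_bargmann_le[of f z] by simp
  have "(LINT z:\<Omega>|lebesgue. husimi (bargmann f) z) \<le> (LINT z:\<Omega>|lebesgue. 1)"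
    using f le by (intro set_integral_mono husimi_set_integrable[where C=1] assms bargmann_holomorphic
        bounded_set_integrable[where C=1]) auto
  then show "(LINT z:\<Omega>|lebesgue. husimi (bargmann f) z) \<le> (LINT z:\<Omega>|lebesgue. 1)" .
qed

lemma husimi_scale: "husimi (\<lambda>z. s * F z) z = (cmod s)\<^sup>2 * husimi F z"
  by (simp add: husimi_def norm_mult power_mult_distrib)

lemma bargmann_scale: "bargmann (\<lambda>t. s * f t) z = s * bargmann f z"
  unfolding bargmann_def by (simp add: mult.assoc)

text \<open>Homogeneous form of the definition, usable for test vectors that are not normalized.\<close>
lemma husimi_mass_le_lambda1:
  assumes \<Omega>: "\<Omega> \<in> lmeasurable" and f: "f \<in> L2"
  shows "(LINT z:\<Omega>|lebesgue. husimi (bargmann f) z) \<le> lambda1 gauss_window \<Omega> * (L2_norm f)\<^sup>2"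
proof (cases "L2_norm f = 0")
  case True
  then have "husimi (bargmann f) z = 0" for z
    using husimi_bargmann_le[OF f, of z] husimi_nonneg[of "bargmann f" z] by simp
  then show ?thesis using True by simp
next
  case False
  define c where "c = L2_norm f"
  define g where "g = (\<lambda>t. of_real (1 / c) * f t)"
  have c: "c > 0" using False unfolding c_def L2_norm_def by (simp add: less_le)
  have "(L2_norm g)\<^sup>2 = (cmod (of_real (1 / c)))\<^sup>2 * c\<^sup>2" unfolding g_def c_def by (rule L2_scale(2)[OF f])
  then have "(L2_norm g)\<^sup>2 = 1" using c by (simp add: norm_divide power_divide)
  moreover have "L2_norm g \<ge> 0" by (simp add: L2_norm_def)
  ultimately have "L2_norm g = 1" by (simp add: power2_eq_1_iff)
  moreover have "g \<in> L2" unfolding g_def by (rule L2_scale(1)[OF f])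
  ultimately have le: "(LINT z:\<Omega>|lebesgue. husimi (bargmann g) z) \<le> lambda1 gauss_window \<Omega>"
    unfolding lambda1_gauss_eq by (intro cSUP_upper husimi_mass_bdd \<Omega>) auto
  have "husimi (bargmann g) z = (1 / c\<^sup>2) * husimi (bargmann f) z" for z
    using husimi_scale[of "of_real (1 / c)" "bargmann f" z] bargmann_scale[of "of_real (1 / c)" f]
    by (simp add: g_def husimi_def norm_divide power_divide)
  with le have "(LINT z:\<Omega>|lebesgue. (1 / c\<^sup>2) * husimi (bargmann f) z) \<le> lambda1 gauss_window \<Omega>"
    by (simp only:)
  then have "(1 / c\<^sup>2) * (LINT z:\<Omega>|lebesgue. husimi (bargmann f) z) \<le> lambda1 gauss_window \<Omega>"
    by (simp only: set_integral_mult_right)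
  then show ?thesis using c by (simp add: c_def divide_simps mult.commute)
qed

lemma unit_sphere_nonempty: "{f \<in> L2. L2_norm f = 1} \<noteq> {}"
proof -
  have "(L2_norm (coherent 0))\<^sup>2 = 1" by (simp add: L2_norm_coherent)
  moreover have "L2_norm (coherent 0) \<ge> 0" by (simp add: L2_norm_def)
  ultimately have "L2_norm (coherent 0) = 1" by (simp add: power2_eq_1_iff)
  then show ?thesis using coherent_L2[of 0] by auto
qed

lemma maximizing_sequence:
  assumes \<Omega>: "\<Omega> \<in> lmeasurable"
  obtains f where "\<And>n::nat. f n \<in> L2" "\<And>n. L2_norm (f n) = 1"
    "(\<lambda>n. LINT z:\<Omega>|lebesgue. husimi (bargmann (f n)) z) \<longlonglongrightarrow> lambda1 gauss_window \<Omega>"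
proof -
  let ?m = "\<lambda>f. LINT z:\<Omega>|lebesgue. husimi (bargmann f) z"
  let ?U = "{f \<in> L2. L2_norm f = 1}"
  have "\<exists>f\<in>?U. lambda1 gauss_window \<Omega> - 1 / Suc n < ?m f" for n
  proof -
    have "lambda1 gauss_window \<Omega> - 1 / Suc n < (SUP f\<in>?U. ?m f)"
      by (simp add: lambda1_gauss_eq)
    then show ?thesis using less_cSUP_iff[OF unit_sphere_nonempty husimi_mass_bdd[OF \<Omega>]] by blast
  qed
  then obtain f where f: "\<And>n. f n \<in> ?U" "\<And>n. lambda1 gauss_window \<Omega> - 1 / Suc n < ?m (f n)"
    by metis
  have "(\<lambda>n. ?m (f n)) \<longlonglongrightarrow> lambda1 gauss_window \<Omega>"
  proof (rule tendsto_sandwich)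
    show "\<forall>\<^sub>F n in sequentially. lambda1 gauss_window \<Omega> - 1 / Suc n \<le> ?m (f n)"
      using f(2) by (auto intro!: always_eventually less_imp_le)
    show "\<forall>\<^sub>F n in sequentially. ?m (f n) \<le> lambda1 gauss_window \<Omega>"
      using husimi_mass_le_lambda1[OF \<Omega>, of "f _"] f(1) by (auto intro!: always_eventually)
    show "(\<lambda>n. lambda1 gauss_window \<Omega> - 1 / Suc n) \<longlonglongrightarrow> lambda1 gauss_window \<Omega>"
      using tendsto_diff[OF tendsto_const LIMSEQ_inverse_real_of_nat, of "lambda1 gauss_window \<Omega>"]
      by (simp add: inverse_eq_divide)
  qed simp
  with f(1) show ?thesis by (intro that[of f]) auto
qed

lemma bargmann_cnj_coherent: "bargmann (\<lambda>t. cnj (coherent w t)) z = exp (of_real pi * z * cnj w)"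
  using lebesgue_has_bochner_integral[OF coherent_inner[of z w]]
  by (simp add: bargmann_def has_bochner_integral_iff mult.commute)

lemma husimi_add_le: "husimi (\<lambda>z. F z + G z) z \<le> 2 * husimi F z + 2 * husimi G z"
proof -
  have "(cmod (F z + G z))\<^sup>2 \<le> (cmod (F z) + cmod (G z))\<^sup>2"
    by (intro power_mono norm_triangle_ineq) auto
  also have "\<dots> \<le> 2 * (cmod (F z))\<^sup>2 + 2 * (cmod (G z))\<^sup>2"
    using sum_squares_bound[of "cmod (F z)" "cmod (G z)"] by (simp add: power2_eq_square algebra_simps)
  finally have "husimi (\<lambda>z. F z + G z) z \<le> (2 * (cmod (F z))\<^sup>2 + 2 * (cmod (G z))\<^sup>2) * exp (- pi * (cmod z)\<^sup>2)"
    unfolding husimi_def by (rule mult_right_mono) simp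
  then show ?thesis by (simp add: husimi_def ring_distribs)
qed

lemma husimi_mass_tendsto:
  assumes \<Omega>: "\<Omega> \<in> lmeasurable" and hol: "\<And>n. F n holomorphic_on UNIV" "G holomorphic_on UNIV"
    and lim: "\<And>z. (\<lambda>n. F n z) \<longlonglongrightarrow> G z" and bd: "\<And>n z. husimi (F n) z \<le> C"
  shows "(\<lambda>n. LINT z:\<Omega>|lebesgue. husimi (F n) z) \<longlonglongrightarrow> (LINT z:\<Omega>|lebesgue. husimi G z)"
proof -
  have lim': "(\<lambda>n. husimi (F n) z) \<longlonglongrightarrow> husimi G z" for z
    unfolding husimi_def by (intro tendsto_intros lim)
  have bd': "husimi G z \<le> C" for z
    using lim'[of z] by (rule LIMSEQ_le_const2) (use bd in auto)
  show ?thesis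
    unfolding set_lebesgue_integral_def
  proof (rule integral_dominated_convergence[where w = "\<lambda>z. indicator \<Omega> z * C"])
    show "integrable lebesgue (\<lambda>z. indicator \<Omega> z * C)"
      using \<Omega> by (intro integrable_mult_left integrable_real_indicator) (auto simp: fmeasurable_def)
    show "(\<lambda>z. indicator \<Omega> z *\<^sub>R husimi G z) \<in> borel_measurable lebesgue"
      using husimi_set_integrable[OF \<Omega> hol(2) bd'] by (auto simp: set_integrable_def)
    show "(\<lambda>z. indicator \<Omega> z *\<^sub>R husimi (F i) z) \<in> borel_measurable lebesgue" for i
      using husimi_set_integrable[OF \<Omega> hol(1) bd] by (auto simp: set_integrable_def)
    show "AE z in lebesgue. (\<lambda>i. indicator \<Omega> z *\<^sub>R husimi (F i) z) \<longlonglongrightarrow> indicator \<Omega> z *\<^sub>R husimi G z"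
      by (intro AE_I2 tendsto_intros lim')
    show "AE z in lebesgue. norm (indicator \<Omega> z *\<^sub>R husimi (F i) z) \<le> indicator \<Omega> z * C" for i
      using bd by (intro AE_I2) (auto simp: indicator_def)
  qed
qed

section \<open>Extremal functions and their eigenvalue equation\<close>

text \<open>The first-order condition at a maximum: a real-linear function of \<open>s\<close> that is bounded by a quadratic
  one vanishes.\<close>
lemma quadratic_bound_zero:
  fixes D :: complex
  assumes "\<And>s. 2 * Re (cnj s * D) \<le> (cmod s)\<^sup>2 * C"
  shows "D = 0"
proof (rule ccontr)
  assume "D \<noteq> 0"
  \<comment> \<open>Any \<open>e > 0\<close> with \<open>e * C < 2\<close> makes \<open>s = e * D\<close> violate the bound.\<close>
  define e where "e = 1 / (1 + \<bar>C\<bar>)"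
  have e: "e > 0" "e * C < 2" 
    by (auto simp: e_def divide_simps abs_if split: if_splits)
  have "2 * (e * (cmod D)\<^sup>2) \<le> e\<^sup>2 * (cmod D)\<^sup>2 * C"
  proof -
    have "cnj (of_real e * D) * D = of_real (e * (cmod D)\<^sup>2)"
      using complex_norm_square[of D] by (simp add: mult.commute mult.left_commute)
    then have "Re (cnj (of_real e * D) * D) = e * (cmod D)\<^sup>2"
      by (simp only: Re_complex_of_real)
    then show ?thesis
      using assms[of "of_real e * D"] e(1) by (simp only: norm_mult power_mult_distrib) simp
  qed
  then have "2 * (e * (cmod D)\<^sup>2) \<le> (e * C) * (e * (cmod D)\<^sup>2)"
    by (simp add: power2_eq_square mult_ac)
  then show False using e \<open>D \<noteq> 0\<close> by (simp add: mult.commute)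
qed

lemma husimi_add_scale:
  "husimi (\<lambda>z. F z + s * G z) z = husimi F z
     + 2 * Re (cnj s * (F z * cnj (G z) * of_real (exp (- pi * (cmod z)\<^sup>2)))) + (cmod s)\<^sup>2 * husimi G z"
proof -
  have "(cmod (F z + s * G z))\<^sup>2 = (cmod (F z))\<^sup>2 + 2 * Re (cnj s * (F z * cnj (G z))) + (cmod s)\<^sup>2 * (cmod (G z))\<^sup>2"
    unfolding cmod_power2 by (simp add: power2_eq_square algebra_simps)
  moreover have "Re (cnj s * (F z * cnj (G z) * of_real (exp (- pi * (cmod z)\<^sup>2))))
     = Re (cnj s * (F z * cnj (G z))) * exp (- pi * (cmod z)\<^sup>2)"
    by (simp only: mult.assoc[symmetric] Re_complex_of_real times_complex.sel Im_complex_of_real mult_zero_right diff_zero)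
  ultimately show ?thesis unfolding husimi_def by (simp only: ring_distribs mult.assoc)
qed

lemma sqrt_husimi: "sqrt (husimi F z) = cmod (F z) * exp (- pi * (cmod z)\<^sup>2 / 2)"
proof -
  have "husimi F z = (cmod (F z) * exp (- pi * (cmod z)\<^sup>2 / 2))\<^sup>2"
    by (simp add: husimi_def power_mult_distrib power2_eq_square[of "exp _"] flip: exp_add)
  then show ?thesis by (simp add: real_sqrt_unique)
qed

text \<open>The kernel of the orthogonal projection to the Fock space, including the weight in the integration
  variable \<open>w\<close>.\<close>
definition fock_kernel :: "complex \<Rightarrow> complex \<Rightarrow> complex" where
  "fock_kernel z w = exp (of_real pi * z * cnj w) * of_real (exp (- pi * (cmod w)\<^sup>2))"

lemma fock_kernel_norm:
  "cmod (fock_kernel z w) = exp (pi * (cmod z)\<^sup>2 / 2 - pi * (cmod w)\<^sup>2 / 2 - pi * (cmod (z - w))\<^sup>2 / 2)"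
proof -
  have "cmod (fock_kernel z w) = exp (pi * Re (z * cnj w) - pi * (cmod w)\<^sup>2)"
    unfolding fock_kernel_def norm_mult norm_exp_eq_Re norm_of_real abs_exp_cancel exp_add[symmetric]
    by (rule arg_cong[where f=exp]) (simp add: algebra_simps)
  also have "pi * Re (z * cnj w) - pi * (cmod w)\<^sup>2 = pi * (cmod z)\<^sup>2 / 2 - pi * (cmod w)\<^sup>2 / 2 - pi * (cmod (z - w))\<^sup>2 / 2"
    unfolding cmod_power2 by (simp add: power2_eq_square field_simps)
  finally show ?thesis .
qed

text \<open>If each variable carries half of the weight, the modulus of the kernel is a Gaussian in \<open>z - w\<close>.\<close>
lemma kernel_times_norm:
  "cmod (F w * fock_kernel z w) = exp (pi * (cmod z)\<^sup>2 / 2) * (sqrt (husimi F w) * exp (- pi * (cmod (z - w))\<^sup>2 / 2))"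
proof -
  have "exp (pi * (cmod z)\<^sup>2 / 2 - pi * (cmod w)\<^sup>2 / 2 - pi * (cmod (z - w))\<^sup>2 / 2)
      = exp (pi * (cmod z)\<^sup>2 / 2) * (exp (- pi * (cmod w)\<^sup>2 / 2) * exp (- pi * (cmod (z - w))\<^sup>2 / 2))"
    unfolding exp_add[symmetric] by (rule arg_cong[where f=exp]) simp
  then show ?thesis unfolding norm_mult fock_kernel_norm sqrt_husimi by simp
qed

lemma fock_kernel_measurable [measurable]: "(\<lambda>w. fock_kernel z w) \<in> borel_measurable borel"
  unfolding fock_kernel_def by (intro borel_measurable_continuous_onI continuous_intros)

lemma kernel_product_set_integrable:
  assumes \<Omega>: "\<Omega> \<in> lmeasurable" and F: "F holomorphic_on UNIV" and bd: "\<And>w. husimi F w \<le> C"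
  shows "set_integrable lebesgue \<Omega> (\<lambda>w. F w * fock_kernel z w)"
proof (rule bounded_set_integrable[OF \<Omega>])
  have "F \<in> borel_measurable borel"
    by (intro borel_measurable_continuous_onI holomorphic_on_imp_continuous_on F)
  then show "(\<lambda>w. F w * fock_kernel z w) \<in> borel_measurable borel" by measurable
  fix w
  have "sqrt (husimi F w) * exp (- pi * (cmod (z - w))\<^sup>2 / 2) \<le> sqrt C * 1"
    using bd[of w] order_trans[OF husimi_nonneg bd[of w]] by (intro mult_mono) auto
  then show "norm (F w * fock_kernel z w) \<le> exp (pi * (cmod z)\<^sup>2 / 2) * (sqrt C * 1)"
    unfolding kernel_times_norm by (rule mult_left_mono) simp
qed

text \<open>Bargmann transforms of unit vectors are locally uniformly bounded, so Montel's theorem turns a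
  maximizing sequence \<open>f n\<close> into an entire limit \<open>F\<close>. On sets of finite measure the densities are
  dominated by \<open>1\<close>, so all masses pass to the limit. In particular \<open>F\<close> inherits the estimates
  needed below even before it is known to be the transform of a vector.

  The eigenvalue equation at \<open>w\<close> is the Euler equation for the perturbations \<open>f n + s h\<close> with \<open>h\<close> the
  conjugated coherent state at \<open>w\<close>, because the inner product of \<open>f n\<close> with \<open>h\<close> is the value of its
  Bargmann transform at \<open>w\<close>.\<close>
lemma maximizer_exists:
  assumes \<Omega>: "\<Omega> \<in> lmeasurable"
  obtains F where "F holomorphic_on UNIV" "\<And>z. husimi F z \<le> 1"
    "(LINT z:\<Omega>|lebesgue. husimi F z) = lambda1 gauss_window \<Omega>"
    "\<And>E. E \<in> lmeasurable \<Longrightarrow> (LINT z:E|lebesgue. husimi F z) \<le> lambda1 gauss_window E"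
    "\<And>z. of_real (lambda1 gauss_window \<Omega>) * F z = (LINT w:\<Omega>|lebesgue. F w * fock_kernel z w)"
proof -
  define l where "l = lambda1 gauss_window \<Omega>"
  obtain f where f: "\<And>n::nat. f n \<in> L2" "\<And>n. L2_norm (f n) = 1"
    and flim: "(\<lambda>n. LINT z:\<Omega>|lebesgue. husimi (bargmann (f n)) z) \<longlonglongrightarrow> l"
    using maximizing_sequence[OF \<Omega>] unfolding l_def by metis
  have hol: "bargmann (f n) holomorphic_on UNIV" for n by (rule bargmann_holomorphic[OF f(1)])
  have le1: "husimi (bargmann (f n)) z \<le> 1" for n z
    using husimi_bargmann_le[OF f(1), of n z] f(2) by simp
  have bound: "cmod (bargmann (f n) z) \<le> exp (pi * (cmod z)\<^sup>2 / 2)" for n z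
  proof -
    have "cmod (bargmann (f n) z) * exp (- pi * (cmod z)\<^sup>2 / 2) \<le> 1"
      unfolding sqrt_husimi[symmetric] using le1[of n z] by simp
    then show ?thesis by (simp add: exp_minus field_simps)
  qed
  \<comment> \<open>The bound is uniform in \<open>n\<close> on compact sets, so the transforms form a normal family.\<close>
  obtain F r where F: "F holomorphic_on UNIV" and r: "strict_mono (r :: nat \<Rightarrow> nat)"
    and lim: "\<And>z. (\<lambda>n. bargmann (f (r n)) z) \<longlonglongrightarrow> F z"
  proof (rule Montel[of UNIV "range (\<lambda>n. bargmann (f n))" "\<lambda>n. bargmann (f n)"])
    show "\<exists>B. \<forall>h\<in>range (\<lambda>n. bargmann (f n)). \<forall>z\<in>K. cmod (h z) \<le> B" if K: "compact K" for K
    proof -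
      obtain b where b: "\<And>z. z \<in> K \<Longrightarrow> cmod z \<le> b"
        using compact_imp_bounded[OF K] unfolding bounded_iff by blast
      have "cmod (bargmann (f n) z) \<le> exp (pi * b\<^sup>2 / 2)" if "z \<in> K" for n z
        using b[OF that] by (intro order_trans[OF bound]) (simp add: power_mono)
      then show ?thesis by blast
    qed
  qed (use hol in auto)
  have lim': "(\<lambda>n. husimi (bargmann (f (r n))) z) \<longlonglongrightarrow> husimi F z" for z
    unfolding husimi_def by (intro tendsto_intros lim)
  have F1: "husimi F z \<le> 1" for z
    by (rule LIMSEQ_le_const2[OF lim']) (use le1 in auto)
  have mass: "(LINT z:\<Omega>|lebesgue. husimi F z) = l"
  proof (rule LIMSEQ_unique)
    show "(\<lambda>n. LINT z:\<Omega>|lebesgue. husimi (bargmann (f (r n))) z) \<longlonglongrightarrow> (LINT z:\<Omega>|lebesgue. husimi F z)"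
      by (rule husimi_mass_tendsto[OF \<Omega> hol F lim le1])
    show "(\<lambda>n. LINT z:\<Omega>|lebesgue. husimi (bargmann (f (r n))) z) \<longlonglongrightarrow> l"
      using LIMSEQ_subseq_LIMSEQ[OF flim r] by (simp add: comp_def)
  qed
  have massE: "(LINT z:E|lebesgue. husimi F z) \<le> lambda1 gauss_window E" if E: "E \<in> lmeasurable" for E
  proof (rule LIMSEQ_le_const2)
    show "(\<lambda>n. LINT z:E|lebesgue. husimi (bargmann (f (r n))) z) \<longlonglongrightarrow> (LINT z:E|lebesgue. husimi F z)"
      by (rule husimi_mass_tendsto[OF E hol F lim le1])
    show "\<exists>N. \<forall>n\<ge>N. (LINT z:E|lebesgue. husimi (bargmann (f (r n))) z) \<le> lambda1 gauss_window E"
      using husimi_mass_le_lambda1[OF E f(1)] f(2) by simp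
  qed
  have eigen: "of_real l * F w = (LINT z:\<Omega>|lebesgue. F z * fock_kernel w z)" for w
  proof -
    define h where "h = (\<lambda>t. cnj (coherent w t))"
    define H where "H = (\<lambda>z. exp (of_real pi * z * cnj w))"
    define k where "k = (L2_norm h)\<^sup>2"
    have h: "h \<in> L2" unfolding h_def by (rule L2_cnj[OF coherent_L2])
    have bh: "bargmann h z = H z" for z unfolding h_def H_def by (rule bargmann_cnj_coherent)
    have H: "H holomorphic_on UNIV" unfolding H_def by (intro holomorphic_intros)
    have Hk: "husimi H z \<le> k" for z
      using husimi_bargmann_le[OF h, of z] by (simp add: husimi_def bh k_def)
    define I where "I = (LINT z:\<Omega>|lebesgue. F z * fock_kernel w z)"
    have FK: "F z * fock_kernel w z = F z * cnj (H z) * of_real (exp (- pi * (cmod z)\<^sup>2))" for z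
      by (simp add: fock_kernel_def H_def exp_cnj mult_ac)
    have intI: "set_integrable lebesgue \<Omega> (\<lambda>z. F z * fock_kernel w z)"
      by (rule kernel_product_set_integrable[OF \<Omega> F F1])
    have "I - of_real l * F w = 0"
    proof (rule quadratic_bound_zero)
      fix s :: complex
      define B where "B n = bargmann (\<lambda>t. f (r n) t + s * h t)" for n
      have B_eq: "B n = (\<lambda>z. bargmann (f (r n)) z + s * H z)" for n
        unfolding B_def bargmann_add_scale[OF f(1) h] bh ..
      have sum_hol: "(\<lambda>z. F z + s * H z) holomorphic_on UNIV" by (intro holomorphic_intros F H)
      have c1: "(\<lambda>n. LINT z:\<Omega>|lebesgue. husimi (B n) z) \<longlonglongrightarrow> (LINT z:\<Omega>|lebesgue. husimi (\<lambda>z. F z + s * H z) z)"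
      proof (rule husimi_mass_tendsto[OF \<Omega>])
        show "B n holomorphic_on UNIV" for n
          unfolding B_eq by (intro holomorphic_intros hol H)
        show "(\<lambda>n. B n z) \<longlonglongrightarrow> F z + s * H z" for z
          unfolding B_eq by (intro tendsto_intros lim)
        show "husimi (B n) z \<le> 2 + 2 * ((cmod s)\<^sup>2 * k)" for n z
        proof -
          have "husimi (B n) z \<le> 2 * husimi (bargmann (f (r n))) z + 2 * ((cmod s)\<^sup>2 * husimi H z)"
            unfolding B_eq husimi_scale[symmetric] by (rule husimi_add_le)
          also have "\<dots> \<le> 2 * 1 + 2 * ((cmod s)\<^sup>2 * k)"
            by (intro add_mono mult_left_mono le1 Hk) auto
          finally show ?thesis by simp
        qed
      qed (rule sum_hol)
      have c2: "(\<lambda>n. l * (1 + 2 * Re (cnj s * bargmann (f (r n)) w) + (cmod s)\<^sup>2 * k))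
          \<longlonglongrightarrow> l * (1 + 2 * Re (cnj s * F w) + (cmod s)\<^sup>2 * k)"
        by (intro tendsto_intros lim)
      have c3: "(LINT z:\<Omega>|lebesgue. husimi (B n) z) \<le> l * (1 + 2 * Re (cnj s * bargmann (f (r n)) w) + (cmod s)\<^sup>2 * k)" for n
      proof -
        have "(L2_norm (\<lambda>t. f (r n) t + s * h t))\<^sup>2 = 1 + 2 * Re (cnj s * bargmann (f (r n)) w) + (cmod s)\<^sup>2 * k"
          unfolding L2_add_scale(2)[OF f(1) h] f(2) k_def by (simp add: bargmann_def h_def)
        then show ?thesis
          using husimi_mass_le_lambda1[OF \<Omega> L2_add_scale(1)[OF f(1) h], of "r n" s] unfolding B_def l_def by simp
      qed
      \<comment> \<open>The inequality between mass and norm for \<open>f n + s h\<close>, in the limit; at \<open>s = 0\<close> it is an equality.\<close>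
      have le: "(LINT z:\<Omega>|lebesgue. husimi (\<lambda>z. F z + s * H z) z) \<le> l * (1 + 2 * Re (cnj s * F w) + (cmod s)\<^sup>2 * k)"
        using LIMSEQ_le[OF c1 c2] c3 by blast
      have i1: "set_integrable lebesgue \<Omega> (husimi F)" by (rule husimi_set_integrable[OF \<Omega> F F1])
      have i2: "set_integrable lebesgue \<Omega> (husimi H)" by (rule husimi_set_integrable[OF \<Omega> H Hk])
      have i3: "set_integrable lebesgue \<Omega> (\<lambda>z. cnj s * (F z * fock_kernel w z))"
        using intI by (rule set_integrable_mult_right)
      have i4: "set_integrable lebesgue \<Omega> (\<lambda>z. Re (cnj s * (F z * fock_kernel w z)))"
        using integrable_Re[OF i3[unfolded set_integrable_def]] unfolding set_integrable_def by simp
      have R: "(LINT z:\<Omega>|lebesgue. Re (cnj s * (F z * fock_kernel w z))) = Re (cnj s * I)"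
        using integral_Re[OF i3[unfolded set_integrable_def]]
        unfolding I_def set_integral_mult_right[symmetric] unfolding set_lebesgue_integral_def by simp
      have "(LINT z:\<Omega>|lebesgue. husimi (\<lambda>z. F z + s * H z) z)
          = (LINT z:\<Omega>|lebesgue. husimi F z + 2 * Re (cnj s * (F z * fock_kernel w z)) + (cmod s)\<^sup>2 * husimi H z)"
        unfolding husimi_add_scale FK ..
      also have "\<dots> = (LINT z:\<Omega>|lebesgue. husimi F z) + 2 * (LINT z:\<Omega>|lebesgue. Re (cnj s * (F z * fock_kernel w z)))
           + (cmod s)\<^sup>2 * (LINT z:\<Omega>|lebesgue. husimi H z)"
        unfolding set_integral_mult_right[symmetric]
        by (subst set_integral_add(2)[symmetric] | (intro set_integrable_mult_right set_integral_add(1) i1 i2 i4; fail))+ simp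
      finally have "(LINT z:\<Omega>|lebesgue. husimi (\<lambda>z. F z + s * H z) z)
          = l + 2 * Re (cnj s * I) + (cmod s)\<^sup>2 * (LINT z:\<Omega>|lebesgue. husimi H z)"
        unfolding R mass .
      moreover have "Re (cnj s * (of_real l * F w)) = l * Re (cnj s * F w)"
        by (simp add: algebra_simps)
      ultimately show "2 * Re (cnj s * (I - of_real l * F w)) \<le> (cmod s)\<^sup>2 * (l * k - (LINT z:\<Omega>|lebesgue. husimi H z))"
        using le by (simp only: right_diff_distrib minus_complex.sel) (simp add: algebra_simps)
    qed
    then show ?thesis by (simp add: I_def)
  qed
  show ?thesis
    by (rule that[OF F F1 mass[unfolded l_def] massE eigen[unfolded l_def]])
qed

section \<open>The local bathtub principle\<close>

lemma sets_of_measure_iff: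
  assumes "a \<ge> 0"
  shows "S \<in> sets_of_measure a \<longleftrightarrow> S \<in> lmeasurable \<and> measure lebesgue S = a"
proof
  assume "S \<in> sets_of_measure a"
  then show "S \<in> lmeasurable \<and> measure lebesgue S = a"
    using assms by (auto simp: sets_of_measure_def fmeasurable_def measure_def)
next
  assume "S \<in> lmeasurable \<and> measure lebesgue S = a"
  then show "S \<in> sets_of_measure a"
    by (auto simp: sets_of_measure_def emeasure_eq_measure2 fmeasurableD)
qed

text \<open>The function is increasing, and it grows by no more than the area of the disk does.\<close>
lemma measure_Int_cball_continuous:
  fixes A :: "complex set"
  assumes A: "A \<in> sets lebesgue"
  shows "continuous_on {0..} (\<lambda>r. measure lebesgue (A \<inter> cball 0 r))"
proof -
  define m where "m r = measure lebesgue (A \<inter> cball 0 r)" for r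
  define g where "g r = unit_ball_vol 2 * r\<^sup>2" for r :: real
  have fin: "A \<inter> cball 0 r \<in> lmeasurable" "cball 0 r \<in> lmeasurable" for r
    using fmeasurable_Int_fmeasurable[OF lmeasurable_cball A] by (auto simp: Int_commute)
  have step: "0 \<le> m s - m r \<and> m s - m r \<le> g s - g r" if "0 \<le> r" "r \<le> s" for r s
  proof -
    have sub: "cball 0 r \<subseteq> (cball 0 s :: complex set)" using that by auto
    have 1: "m s - m r = measure lebesgue (A \<inter> cball 0 s - A \<inter> cball 0 r)"
      unfolding m_def using sub fin by (intro measurable_measure_Diff[symmetric]) auto
    also have "\<dots> \<le> measure lebesgue (cball 0 s - cball 0 r :: complex set)"
      using fin by (intro measure_mono_fmeasurable) auto
    also have "\<dots> = measure lebesgue (cball 0 s :: complex set) - measure lebesgue (cball 0 r :: complex set)"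
      using sub fin by (intro measurable_measure_Diff) auto
    also have "\<dots> = g s - g r"
      using that content_cball[of s "0::complex"] content_cball[of r "0::complex"] by (simp add: g_def)
    finally show ?thesis using 1 by simp
  qed
  have "continuous_on {0..} m"
    unfolding continuous_on_iff
  proof (intro ballI allI impI)
    fix x e :: real assume x: "x \<in> {0..}" and e: "e > 0"
    have "continuous_on {0..} g" unfolding g_def by (intro continuous_intros)
    then obtain d where d: "d > 0" "\<And>y. y \<in> {0..} \<Longrightarrow> dist y x < d \<Longrightarrow> dist (g y) (g x) < e"
      unfolding continuous_on_iff using x e by metis
    have "dist (m y) (m x) < e" if "y \<in> {0..}" "dist y x < d" for y
      using d(2)[OF that] step[of x y] step[of y x] x that by (cases "x \<le> y") (auto simp: dist_real_def)
    with d(1) show "\<exists>d>0. \<forall>y\<in>{0..}. dist y x < d \<longrightarrow> dist (m y) (m x) < e" by blast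
  qed
  then show ?thesis by (simp add: m_def)
qed

text \<open>Lebesgue measure has no atoms: cut with centered disks and use the intermediate value theorem.\<close>
lemma subset_of_small_measure:
  fixes A :: "complex set"
  assumes A: "A \<in> sets lebesgue" and nn: "A \<notin> null_sets lebesgue"
  obtains \<eta> where "\<eta> > 0" "\<And>s. 0 \<le> s \<Longrightarrow> s \<le> \<eta> \<Longrightarrow> \<exists>B\<subseteq>A. B \<in> lmeasurable \<and> measure lebesgue B = s"
proof -
  have fin: "A \<inter> cball 0 r \<in> lmeasurable" for r
    using fmeasurable_Int_fmeasurable[OF lmeasurable_cball A] by (auto simp: Int_commute)
  obtain n :: nat where n: "A \<inter> cball 0 (real n) \<notin> null_sets lebesgue"
  proof (rule ccontr)
    assume c: "\<not> thesis"
    then have "(\<Union>n::nat. A \<inter> cball 0 (real n)) \<in> null_sets lebesgue"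
      using that by (intro null_sets_UN) auto
    moreover have "(\<Union>n::nat. A \<inter> cball 0 (real n)) = A"
      using real_arch_simple by (auto simp: mem_cball)
    ultimately show False using nn by simp
  qed
  define \<eta> where "\<eta> = measure lebesgue (A \<inter> cball 0 (real n))"
  have "emeasure lebesgue (A \<inter> cball 0 (real n)) \<noteq> 0"
    using n fin[of "real n"] by (auto simp: null_sets_def fmeasurableD)
  then have pos: "\<eta> > 0"
    using fin[of "real n"] unfolding \<eta>_def
    by (metis emeasure_eq_measure2 ennreal_0 measure_nonneg less_eq_real_def)
  show ?thesis
  proof (rule that[OF pos])
    fix s assume s: "0 \<le> s" "s \<le> \<eta>"
    have "measure lebesgue (A \<inter> cball 0 0) = 0"
      by (rule measure_eq_0_null_sets) 
         (metis fin finite_Int finite.emptyI finite_insert cball_trivial negligible_finite negligible_iff_null_sets)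
    then have "\<exists>x. 0 \<le> x \<and> x \<le> real n \<and> measure lebesgue (A \<inter> cball 0 x) = s"
      using s by (intro IVT') (auto simp: \<eta>_def intro: continuous_on_subset[OF measure_Int_cball_continuous[OF A]])
    then show "\<exists>B\<subseteq>A. B \<in> lmeasurable \<and> measure lebesgue B = s"
      using fin by blast
  qed
qed

lemma d_w_le_measure:
  assumes "sym_diff S E \<in> lmeasurable"
  shows "d_w S E \<le> measure lebesgue (sym_diff S E)"
proof -
  have "d_w S E \<le> (LINT z:sym_diff S E|lebesgue. 1)"
    unfolding d_w_def
    by (intro set_integral_mono bounded_set_integrable[where C=1] assms
          borel_measurable_continuous_onI continuous_intros) auto
  also have "\<dots> = measure lebesgue (sym_diff S E)"
    using assms by (simp add: set_lebesgue_integral_def fmeasurableD2)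
  finally show ?thesis .
qed

lemma set_integral_positive:
  fixes f :: "complex \<Rightarrow> real"
  assumes B: "B \<in> lmeasurable" "B \<notin> null_sets lebesgue" and int: "set_integrable lebesgue B f"
    and pos: "\<And>z. z \<in> B \<Longrightarrow> 0 < f z"
  shows "0 < (LINT z:B|lebesgue. f z)"
proof (rule ccontr)
  assume neg: "\<not> ?thesis"
  have nonneg: "0 \<le> indicator B z *\<^sub>R f z" for z using pos[of z] by (auto simp: indicator_def)
  have "0 \<le> (LINT z:B|lebesgue. f z)"
    unfolding set_lebesgue_integral_def by (rule Bochner_Integration.integral_nonneg) (rule nonneg)
  with neg have "(LINT z:B|lebesgue. f z) = 0" by simp
  then have "AE z in lebesgue. indicator B z *\<^sub>R f z = 0"
    using integral_nonneg_eq_0_iff_AE[OF int[unfolded set_integrable_def]] nonneg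
    unfolding set_lebesgue_integral_def by auto
  then have "AE z in lebesgue. z \<notin> B"
    by eventually_elim (use pos in \<open>force simp: indicator_def split: if_splits\<close>)
  then have "B \<in> null_sets lebesgue" using B(1) by (simp add: AE_iff_null_sets fmeasurableD)
  with B(2) show False by simp
qed

text \<open>If the conclusion failed, then a small piece of \<open>S\<close> on which \<open>u < s\<close> could be exchanged for a piece of
  the same measure outside \<open>S\<close> on which \<open>u > s\<close>; the new set is as close to \<open>S\<close> as desired and carries
  more mass.\<close>
lemma bathtub_swap:
  fixes u :: "complex \<Rightarrow> real"
  assumes a: "a > 0" and S: "S \<in> sets_of_measure a" and \<delta>: "\<delta> > 0"
    and u: "continuous_on UNIV u" "\<And>z. 0 \<le> u z" "\<And>z. u z \<le> C"
    and opt: "\<And>E. E \<in> sets_of_measure a \<Longrightarrow> d_w S E < \<delta> \<Longrightarrow> (LINT z:E|lebesgue. u z) \<le> (LINT z:S|lebesgue. u z)"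
    and low: "S \<inter> {z. u z < s} \<notin> null_sets lebesgue"
  shows "{z. u z > s} - S \<in> null_sets lebesgue"
proof (rule ccontr)
  assume high: "{z. u z > s} - S \<notin> null_sets lebesgue"
  have ub: "u \<in> borel_measurable borel" by (rule borel_measurable_continuous_onI[OF u(1)])
  have Sm: "S \<in> lmeasurable" "measure lebesgue S = a" using S a by (auto simp: sets_of_measure_iff)
  have lev: "{z. u z < s} \<in> sets lebesgue" "{z. u z > s} \<in> sets lebesgue"
  proof -
    have "{z. u z < s} \<in> sets borel" "{z. u z > s} \<in> sets borel" using ub by measurable
    then show "{z. u z < s} \<in> sets lebesgue" "{z. u z > s} \<in> sets lebesgue" by auto
  qed
  obtain \<eta>1 where e1: "\<eta>1 > 0" "\<And>r. 0 \<le> r \<Longrightarrow> r \<le> \<eta>1 \<Longrightarrow> \<exists>B\<subseteq>S \<inter> {z. u z < s}. B \<in> lmeasurable \<and> measure lebesgue B = r"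
    by (rule subset_of_small_measure[OF _ low]) (use Sm lev in \<open>auto simp: fmeasurableD\<close>)
  obtain \<eta>2 where e2: "\<eta>2 > 0" "\<And>r. 0 \<le> r \<Longrightarrow> r \<le> \<eta>2 \<Longrightarrow> \<exists>B\<subseteq>{z. u z > s} - S. B \<in> lmeasurable \<and> measure lebesgue B = r"
    by (rule subset_of_small_measure[OF _ high]) (use Sm lev in \<open>auto simp: fmeasurableD\<close>)
  \<comment> \<open>The symmetric difference of \<open>S\<close> and the new set has measure \<open>2 * \<eta> < \<delta>\<close>, and the weight is at most \<open>1\<close>.\<close>
  define \<eta> where "\<eta> = min (min \<eta>1 \<eta>2) (\<delta> / 3)"
  have \<eta>: "\<eta> > 0" "\<eta> \<le> \<eta>1" "\<eta> \<le> \<eta>2" "2 * \<eta> < \<delta>" using e1 e2 \<delta> by (auto simp: \<eta>_def)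
  obtain A where A: "A \<subseteq> S \<inter> {z. u z < s}" "A \<in> lmeasurable" "measure lebesgue A = \<eta>" using e1(2)[of \<eta>] \<eta> by auto
  obtain B where B: "B \<subseteq> {z. u z > s} - S" "B \<in> lmeasurable" "measure lebesgue B = \<eta>" using e2(2)[of \<eta>] \<eta> by auto
  define E where "E = (S - A) \<union> B"
  have disj: "(S - A) \<inter> B = {}" "A \<inter> B = {}" "(S - A) \<inter> A = {}" using A B by auto
  have SA: "S - A \<in> lmeasurable" using Sm A by (intro fmeasurable_Diff) (auto simp: fmeasurableD)
  have Em: "E \<in> lmeasurable" unfolding E_def using SA B by auto
  have "measure lebesgue E = measure lebesgue (S - A) + measure lebesgue B"
    unfolding E_def using SA B disj by (intro measure_Un_AE) auto
  also have "measure lebesgue (S - A) = a - \<eta>"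
    using Sm A by (subst measurable_measure_Diff) (auto simp: fmeasurableD)
  finally have "E \<in> sets_of_measure a" using Em B a by (simp add: sets_of_measure_iff)
  moreover have "d_w S E < \<delta>"
  proof -
    have sd: "sym_diff S E = A \<union> B" unfolding E_def using A B by auto
    have "d_w S E \<le> measure lebesgue (A \<union> B)"
      using d_w_le_measure[of S E] A B unfolding sd by auto
    also have "\<dots> = 2 * \<eta>"
      using A B disj by (subst measure_Un_AE) auto
    finally show ?thesis using \<eta> by simp
  qed
  ultimately have le: "(LINT z:E|lebesgue. u z) \<le> (LINT z:S|lebesgue. u z)" by (rule opt)
  have int: "set_integrable lebesgue X u" if "X \<in> lmeasurable" for X :: "complex set"
    by (rule bounded_set_integrable[OF that ub, of C]) (use u in auto)
  have ints: "set_integrable lebesgue X (\<lambda>z. s)" if "X \<in> lmeasurable" for X :: "complex set"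
    by (rule bounded_set_integrable[OF that, of _ "\<bar>s\<bar>"]) auto
  have const: "(LINT z:X|lebesgue. s) = s * measure lebesgue X" if "X \<in> lmeasurable" for X :: "complex set"
    using that by (simp add: set_lebesgue_integral_def fmeasurableD2)
  have "(LINT z:E|lebesgue. u z) = (LINT z:S - A|lebesgue. u z) + (LINT z:B|lebesgue. u z)"
    unfolding E_def using SA B by (intro set_integral_Un int disj) auto
  moreover have "(LINT z:S|lebesgue. u z) = (LINT z:S - A|lebesgue. u z) + (LINT z:A|lebesgue. u z)"
    using set_integral_Un[OF disj(3) int[OF SA] int[OF A(2)]] A(1) by (simp add: Un_absorb2 le_infI1)
  ultimately have BA: "(LINT z:B|lebesgue. u z) \<le> (LINT z:A|lebesgue. u z)" using le by simp
  have "(LINT z:A|lebesgue. u z) \<le> (LINT z:A|lebesgue. s)"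
    using A by (intro set_integral_mono int ints) auto
  then have Ale: "(LINT z:A|lebesgue. u z) \<le> s * \<eta>" using const[OF A(2)] A(3) by simp
  have "B \<notin> null_sets lebesgue" using B(3) \<eta>(1) by (auto dest: measure_eq_0_null_sets)
  then have "0 < (LINT z:B|lebesgue. u z - s)"
    using B by (intro set_integral_positive set_integral_diff(1) int ints) auto
  then have "0 < (LINT z:B|lebesgue. u z) - s * \<eta>"
    using set_integral_diff(2)[OF int[OF B(2)] ints[OF B(2)]] const[OF B(2)] B(3) by simp
  with BA Ale show False by simp
qed

text \<open>The level \<open>t\<close> is the supremum of all \<open>s\<close> such that \<open>u \<ge> s\<close> almost everywhere on \<open>S\<close>. If it were zero,
  then \<open>S\<close> would contain almost every point where \<open>u > 0\<close>, hence almost all of the plane, although it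
  has finite measure.\<close>
lemma local_bathtub:
  fixes u :: "complex \<Rightarrow> real"
  assumes a: "a > 0" and S: "S \<in> sets_of_measure a" and \<delta>: "\<delta> > 0"
    and u: "continuous_on UNIV u" "\<And>z. 0 \<le> u z" "\<And>z. u z \<le> C"
    and opt: "\<And>E. E \<in> sets_of_measure a \<Longrightarrow> d_w S E < \<delta> \<Longrightarrow> (LINT z:E|lebesgue. u z) \<le> (LINT z:S|lebesgue. u z)"
    and zeros: "{z. u z = 0} \<in> null_sets lebesgue"
  obtains t where "t > 0" "{z. u z > t} - S \<in> null_sets lebesgue" "S - {z. u z \<ge> t} \<in> null_sets lebesgue"
proof -
  define T where "T = {s. S \<inter> {z. u z < s} \<in> null_sets lebesgue}"
  define t where "t = Sup T"
  have Sm: "S \<in> lmeasurable" "measure lebesgue S = a" using S a by (auto simp: sets_of_measure_iff)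
  have Snn: "S \<notin> null_sets lebesgue" using Sm a by (auto dest: measure_eq_0_null_sets)
  have meas: "{z. u z < s} \<in> sets lebesgue" for s
  proof -
    have "{z. u z < s} \<in> sets borel" using borel_measurable_continuous_onI[OF u(1)] by measurable
    then show ?thesis by auto
  qed
  have down: "s \<in> T" if "s' \<in> T" "s \<le> s'" for s s'
  proof -
    have "S \<inter> {z. u z < s} \<in> sets lebesgue" using meas Sm by (auto simp: fmeasurableD)
    moreover have "S \<inter> {z. u z < s} \<subseteq> S \<inter> {z. u z < s'}" using that by auto
    ultimately show ?thesis using that(1) unfolding T_def by (auto intro: null_sets_subset)
  qed
  have "S \<inter> {z. u z < C + 1} = S" by (auto intro: le_less_trans[OF u(3)])
  then have "C + 1 \<notin> T" using Snn by (simp add: T_def)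
  then have ub: "s \<le> C + 1" if "s \<in> T" for s using down[OF that, of "C + 1"] by force
  have "\<not> u z < 0" for z using u(2)[of z] by simp
  then have "S \<inter> {z. u z < 0} = {}" by auto
  then have T0: "0 \<in> T" by (simp add: T_def)
  have bdd: "bdd_above T" using ub by (rule bdd_aboveI)
  have t0: "t \<ge> 0" unfolding t_def using T0 bdd by (rule cSup_upper)
  have below: "S \<inter> {z. u z < s} \<in> null_sets lebesgue" if "s < t" for s
    using less_cSupD[of T s] that T0 down unfolding t_def T_def by fastforce
  have "(\<Union>n. S \<inter> {z. u z < t - 1 / real (Suc n)}) \<in> null_sets lebesgue"
    by (intro null_sets_UN below) simp
  moreover have "S - {z. u z \<ge> t} = (\<Union>n. S \<inter> {z. u z < t - 1 / real (Suc n)})"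
  proof (intro equalityI subsetI)
    fix z assume z: "z \<in> S - {z. u z \<ge> t}"
    then obtain n where "1 / real (Suc n) < t - u z" using nat_approx_posE[of "t - u z"] by auto
    then show "z \<in> (\<Union>n. S \<inter> {z. u z < t - 1 / real (Suc n)})" using z by (auto intro!: exI[of _ n])
  next
    fix z assume "z \<in> (\<Union>n. S \<inter> {z. u z < t - 1 / real (Suc n)})"
    then obtain n where n: "z \<in> S" "u z < t - 1 / real (Suc n)" by auto
    have "1 / real (Suc n) > 0" by simp
    with n(2) have "u z < t" by linarith
    with n(1) show "z \<in> S - {z. u z \<ge> t}" by simp
  qed
  ultimately have r2: "S - {z. u z \<ge> t} \<in> null_sets lebesgue" by simp
  have above: "{z. u z > s} - S \<in> null_sets lebesgue" if "s > t" for s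
  proof (rule bathtub_swap[OF a S \<delta> u opt])
    show "S \<inter> {z. u z < s} \<notin> null_sets lebesgue"
      using cSup_upper[OF _ bdd, of s] that unfolding t_def T_def by fastforce
  qed
  have "(\<Union>n. {z. u z > t + 1 / real (Suc n)} - S) \<in> null_sets lebesgue"
    by (intro null_sets_UN above) simp
  moreover have "{z. u z > t} - S = (\<Union>n. {z. u z > t + 1 / real (Suc n)} - S)"
  proof (intro equalityI subsetI)
    fix z assume z: "z \<in> {z. u z > t} - S"
    then obtain n where "1 / real (Suc n) < u z - t" using nat_approx_posE[of "u z - t"] by auto
    then show "z \<in> (\<Union>n. {z. u z > t + 1 / real (Suc n)} - S)" using z by (auto intro!: exI[of _ n])
  next
    fix z assume "z \<in> (\<Union>n. {z. u z > t + 1 / real (Suc n)} - S)"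
    then obtain n where n: "z \<notin> S" "u z > t + 1 / real (Suc n)" by auto
    have "1 / real (Suc n) > 0" by simp
    with n(2) have "u z > t" by linarith
    with n(1) show "z \<in> {z. u z > t} - S" by simp
  qed
  ultimately have r1: "{z. u z > t} - S \<in> null_sets lebesgue" by simp
  have "t \<noteq> 0"
  proof
    assume "t = 0"
    define N where "N = {z. u z = 0} \<union> ({z. u z > t} - S)"
    have N: "N \<in> null_sets lebesgue" unfolding N_def using zeros r1 by (rule null_sets.Un)
    have "UNIV = S \<union> N" using u(2) \<open>t = 0\<close> by (auto simp: N_def order_less_le)
    moreover have "S \<union> N \<in> lmeasurable"
      using Sm N by (intro fmeasurable.Un) (auto simp: fmeasurable_def null_sets_def)
    ultimately have "(UNIV :: complex set) \<in> lmeasurable" by simp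
    then show False by (auto simp: fmeasurable_def)
  qed
  with t0 have "t > 0" by simp
  then show ?thesis by (rule that[OF _ r1 r2])
qed

section \<open>Superlevel sets and level sets of the density\<close>

lemma Complex_measurable [measurable]:
  "(\<lambda>(x, y). Complex x y) \<in> borel_measurable (lborel \<Otimes>\<^sub>M lborel)"
proof -
  have "(\<lambda>p. of_real (fst p) + \<i> * of_real (snd p) :: complex) \<in> borel_measurable (lborel \<Otimes>\<^sub>M lborel)"
    by measurable
  then show ?thesis by (simp add: case_prod_beta' Complex_eq)
qed

lemma lborel_complex: "distr (lborel \<Otimes>\<^sub>M lborel) borel (\<lambda>(x, y). Complex x y) = lborel"
proof (rule lborel_eqI[symmetric])
  fix l u :: complex
  assume le: "\<And>b. b \<in> Basis \<Longrightarrow> l \<bullet> b \<le> u \<bullet> b"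
  then have le': "Re l \<le> Re u" "Im l \<le> Im u"
    using le[of 1] le[of \<i>] by (auto simp: Basis_complex_def inner_complex_def)
  have "(\<lambda>(x, y). Complex x y) -` box l u \<inter> space (lborel \<Otimes>\<^sub>M lborel) = {Re l<..<Re u} \<times> {Im l<..<Im u}"
    by (auto simp: box_def Basis_complex_def space_pair_measure)
  then have "emeasure (distr (lborel \<Otimes>\<^sub>M lborel) borel (\<lambda>(x, y). Complex x y)) (box l u)
      = emeasure (lborel \<Otimes>\<^sub>M lborel) ({Re l<..<Re u} \<times> {Im l<..<Im u})"
    by (subst emeasure_distr) auto
  also have "\<dots> = ennreal (Re u - Re l) * ennreal (Im u - Im l)"
    using le' by (subst lborel.emeasure_pair_measure_Times) auto
  also have "\<dots> = ennreal (\<Prod>b\<in>Basis. (u - l) \<bullet> b)"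
    using le' by (simp add: Basis_complex_def ennreal_mult' inner_complex_def complex_eq_iff)
  finally show "emeasure (distr (lborel \<Otimes>\<^sub>M lborel) borel (\<lambda>(x, y). Complex x y)) (box l u)
      = ennreal (\<Prod>b\<in>Basis. (u - l) \<bullet> b)" .
qed simp

lemma complex_null_set_slices:
  assumes A: "A \<in> sets borel" and slices: "\<And>x. countable {y. Complex x y \<in> A}"
  shows "A \<in> null_sets lborel"
proof -
  have "emeasure lborel A = emeasure (lborel \<Otimes>\<^sub>M lborel) ((\<lambda>(x, y). Complex x y) -` A \<inter> space (lborel \<Otimes>\<^sub>M lborel))"
    using A by (subst lborel_complex[symmetric], subst emeasure_distr) auto
  also have "\<dots> = (\<integral>\<^sup>+x. emeasure lborel (Pair x -` ((\<lambda>(x, y). Complex x y) -` A \<inter> space (lborel \<Otimes>\<^sub>M lborel))) \<partial>lborel)"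
    by (rule lborel.emeasure_pair_measure_alt) (rule measurable_sets[OF Complex_measurable A])
  also have "\<dots> = (\<integral>\<^sup>+x. 0 \<partial>(lborel :: real measure))"
  proof (intro nn_integral_cong)
    fix x :: real
    have "Pair x -` ((\<lambda>(x, y). Complex x y) -` A \<inter> space (lborel \<Otimes>\<^sub>M lborel)) = {y. Complex x y \<in> A}"
      by (auto simp: space_pair_measure)
    then show "emeasure lborel (Pair x -` ((\<lambda>(x, y). Complex x y) -` A \<inter> space (lborel \<Otimes>\<^sub>M lborel))) = 0"
      using countable_imp_null_set_lborel[OF slices[of x]] by (simp add: null_sets_def)
  qed
  finally show ?thesis using A by (simp add: null_sets_def)
qed

lemma complex_integral_slices:
  fixes f :: "complex \<Rightarrow> complex"
  assumes f: "integrable lborel f"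
  shows "(\<integral>z. f z \<partial>lborel) = (\<integral>x. (\<integral>y. f (Complex x y) \<partial>lborel) \<partial>lborel)"
    and "(\<integral>z. f z \<partial>lborel) = (\<integral>y. (\<integral>x. f (Complex x y) \<partial>lborel) \<partial>lborel)"
proof -
  have fb: "f \<in> borel_measurable borel" using f by auto
  have i: "integrable (lborel \<Otimes>\<^sub>M lborel) (\<lambda>(x, y). f (Complex x y))"
    using f by (subst (asm) lborel_complex[symmetric], subst (asm) integrable_distr_eq)
      (auto simp: fb case_prod_beta')
  have e: "(\<integral>z. f z \<partial>lborel) = (\<integral>p. (case p of (x, y) \<Rightarrow> f (Complex x y)) \<partial>(lborel \<Otimes>\<^sub>M lborel))"
    by (subst lborel_complex[symmetric], subst integral_distr) (auto simp: fb case_prod_beta')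
  show 1: "(\<integral>z. f z \<partial>lborel) = (\<integral>x. (\<integral>y. f (Complex x y) \<partial>lborel) \<partial>lborel)"
    unfolding e using lborel_pair.integral_fst'[OF i] by simp
  show "(\<integral>z. f z \<partial>lborel) = (\<integral>y. (\<integral>x. f (Complex x y) \<partial>lborel) \<partial>lborel)"
    unfolding 1 by (rule lborel_pair.Fubini_integral[OF i, symmetric])
qed

text \<open>By the eigenvalue equation, \<open>l * sqrt u\<close> is at most the convolution of a Gaussian with the indicator of
  the finite-measure set \<open>\<Omega>\<close>, and this convolution tends to zero at infinity.\<close>
lemma husimi_superlevel_bounded:
  assumes \<Omega>: "\<Omega> \<in> lmeasurable" and F: "F holomorphic_on UNIV" and bd: "\<And>z. husimi F z \<le> 1"
    and l: "l > 0" and eig: "\<And>z. of_real l * F z = (LINT w:\<Omega>|lebesgue. F w * fock_kernel z w)"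
    and t: "t > 0"
  shows "bounded {z. t \<le> husimi F z}"
proof (rule ccontr)
  assume "\<not> bounded {z. t \<le> husimi F z}"
  then have "\<exists>z. t \<le> husimi F z \<and> real n < cmod z" for n
    unfolding bounded_iff by (auto simp: not_le)
  then obtain Z where Z: "\<And>n. t \<le> husimi F (Z n)" "\<And>n. real n < cmod (Z n)" by metis
  define J where "J z = (LINT w:\<Omega>|lebesgue. exp (- pi * (cmod (z - w))\<^sup>2 / 2))" for z
  have gi: "set_integrable lebesgue \<Omega> (\<lambda>w. exp (- pi * (cmod (z - w))\<^sup>2 / 2))" for z
    by (rule bounded_set_integrable[OF \<Omega>, where C=1]) auto
  have le: "l * sqrt (husimi F z) \<le> J z" for z
  proof -
    have "cmod (of_real l * F z) \<le> (LINT w:\<Omega>|lebesgue. cmod (F w * fock_kernel z w))"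
      unfolding eig set_lebesgue_integral_def
      by (rule order_trans[OF integral_norm_bound]) (simp add: norm_scaleR)
    also have "\<dots> \<le> (LINT w:\<Omega>|lebesgue. exp (pi * (cmod z)\<^sup>2 / 2) * exp (- pi * (cmod (z - w))\<^sup>2 / 2))"
    proof (intro set_integral_mono set_integrable_norm kernel_product_set_integrable[OF \<Omega> F bd] set_integrable_mult_right gi)
      fix w
      have "sqrt (husimi F w) * exp (- pi * (cmod (z - w))\<^sup>2 / 2) \<le> 1 * exp (- pi * (cmod (z - w))\<^sup>2 / 2)"
        using bd[of w] by (intro mult_right_mono) auto
      then show "cmod (F w * fock_kernel z w) \<le> exp (pi * (cmod z)\<^sup>2 / 2) * exp (- pi * (cmod (z - w))\<^sup>2 / 2)"
        unfolding kernel_times_norm by (intro mult_left_mono) auto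
    qed
    also have "\<dots> = exp (pi * (cmod z)\<^sup>2 / 2) * J z" unfolding J_def by (rule set_integral_mult_right)
    finally have "l * cmod (F z) \<le> exp (pi * (cmod z)\<^sup>2 / 2) * J z" using l by (simp add: norm_mult)
    then have "l * cmod (F z) * exp (- pi * (cmod z)\<^sup>2 / 2) \<le> exp (pi * (cmod z)\<^sup>2 / 2) * J z * exp (- pi * (cmod z)\<^sup>2 / 2)"
      by (rule mult_right_mono) simp
    also have "exp (pi * (cmod z)\<^sup>2 / 2) * J z * exp (- pi * (cmod z)\<^sup>2 / 2) = J z"
      by (simp add: exp_minus)
    finally show ?thesis unfolding sqrt_husimi by (simp add: mult.assoc)
  qed
  have "(\<lambda>n. J (Z n)) \<longlonglongrightarrow> (LINT w:\<Omega>|lebesgue. 0)"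
    unfolding J_def set_lebesgue_integral_def
  proof (rule integral_dominated_convergence[where w = "indicator \<Omega>"])
    show "integrable lebesgue (indicator \<Omega> :: complex \<Rightarrow> real)"
      using \<Omega> by (intro integrable_real_indicator) (auto simp: fmeasurable_def)
    show "(\<lambda>w. indicat_real \<Omega> w *\<^sub>R exp (- pi * (cmod (Z i - w))\<^sup>2 / 2)) \<in> borel_measurable lebesgue" for i
      using gi[of "Z i"] by (auto simp: set_integrable_def)
    show "AE w in lebesgue. (\<lambda>i. indicat_real \<Omega> w *\<^sub>R exp (- pi * (cmod (Z i - w))\<^sup>2 / 2)) \<longlonglongrightarrow> indicat_real \<Omega> w *\<^sub>R 0"
    proof (rule AE_I2)
      fix w
      have "filterlim (\<lambda>i. real i + - cmod w) at_top sequentially"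
        by (rule filterlim_tendsto_add_at_top[OF tendsto_const filterlim_real_sequentially, of "- cmod w", simplified add.commute])
      then have f1: "filterlim (\<lambda>i. cmod (Z i - w)) at_top sequentially"
      proof (rule filterlim_at_top_mono)
        show "\<forall>\<^sub>F i in sequentially. real i + - cmod w \<le> cmod (Z i - w)"
        proof (rule always_eventually, rule allI)
          fix i show "real i + - cmod w \<le> cmod (Z i - w)"
            using Z(2)[of i] norm_triangle_ineq2[of "Z i" w] by linarith
        qed
      qed
      have "((\<lambda>x::real. exp (- pi * x\<^sup>2 / 2)) \<longlongrightarrow> 0) at_top" by real_asymp
      from filterlim_compose[OF this f1]
      show "(\<lambda>i. indicat_real \<Omega> w *\<^sub>R exp (- pi * (cmod (Z i - w))\<^sup>2 / 2)) \<longlonglongrightarrow> indicat_real \<Omega> w *\<^sub>R 0"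
        by (intro tendsto_intros)
    qed
    show "AE w in lebesgue. norm (indicat_real \<Omega> w *\<^sub>R exp (- pi * (cmod (Z i - w))\<^sup>2 / 2)) \<le> indicator \<Omega> w" for i
      by (intro AE_I2) (auto simp: indicator_def)
  qed simp
  then have "(\<lambda>n. J (Z n)) \<longlonglongrightarrow> 0" by simp
  moreover have "l * sqrt t \<le> J (Z n)" for n
    using le[of "Z n"] Z(1)[of n] l by (meson mult_left_mono order_trans real_sqrt_le_mono less_imp_le)
  ultimately have "l * sqrt t \<le> 0" by (intro LIMSEQ_le_const[of "\<lambda>n. J (Z n)"]) auto
  then show False using l t by (simp add: mult_le_0_iff)
qed

text \<open>On a line the density is the restriction of an entire function. So either it takes the value \<open>t\<close> finitely
  often on each compact interval, or it equals \<open>t\<close> on the whole line, which does not fit into the bounded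
  set \<open>{u \<ge> t}\<close>.\<close>
lemma husimi_level_slice_finite:
  assumes F: "F holomorphic_on UNIV" and bd: "bounded {z. t \<le> husimi F z}" and d: "d \<noteq> 0"
  shows "finite {x \<in> {a..b}. husimi F (p + of_real x * d) = t}"
proof (rule ccontr)
  assume inf: "infinite {x \<in> {a..b}. husimi F (p + of_real x * d) = t}"
  \<comment> \<open>The entire extension of \<open>x \<mapsto> u (p + x d) - t\<close>: conjugation on both sides makes the factor \<open>cnj F\<close> holomorphic.\<close>
  define h where "h \<zeta> = F (p + \<zeta> * d) * (cnj \<circ> (\<lambda>\<zeta>. F (p + \<zeta> * d)) \<circ> cnj) \<zeta> *
      exp (- of_real pi * (of_real ((cmod p)\<^sup>2) + 2 * \<zeta> * of_real (Re (cnj p * d)) + \<zeta>\<^sup>2 * of_real ((cmod d)\<^sup>2))) - of_real t" for \<zeta>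
  have hol0: "(\<lambda>\<zeta>. F (p + \<zeta> * d)) holomorphic_on UNIV"
    by (rule holomorphic_on_compose_gen[of "\<lambda>\<zeta>. p + \<zeta> * d" UNIV F UNIV, unfolded comp_def])
       (auto intro!: holomorphic_intros F)
  have hol: "h holomorphic_on UNIV"
    unfolding h_def
    by (intro holomorphic_intros hol0 holomorphic_on_compose_cnj_cnj) (auto intro: holomorphic_on_subset[OF hol0])
  have real: "h (of_real x) = of_real (husimi F (p + of_real x * d) - t)" for x :: real
  proof -
    have n: "(cmod (p + of_real x * d))\<^sup>2 = (cmod p)\<^sup>2 + 2 * x * Re (cnj p * d) + x\<^sup>2 * (cmod d)\<^sup>2"
      unfolding cmod_power2 by (simp add: power2_eq_square algebra_simps)
    have "h (of_real x) = F (p + of_real x * d) * cnj (F (p + of_real x * d)) *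
        exp (of_real (- pi * (cmod (p + of_real x * d))\<^sup>2)) - of_real t"
      unfolding h_def n by simp
    also have "\<dots> = of_real (husimi F (p + of_real x * d) - t)"
      unfolding complex_norm_square[symmetric] husimi_def exp_of_real by simp
    finally show ?thesis .
  qed
  define K where "K = complex_of_real ` {a..b}"
  have "infinite {\<zeta> \<in> K. h \<zeta> = 0}"
  proof
    assume fin: "finite {\<zeta> \<in> K. h \<zeta> = 0}"
    have "complex_of_real ` {x \<in> {a..b}. husimi F (p + of_real x * d) = t} \<subseteq> {\<zeta> \<in> K. h \<zeta> = 0}"
      by (auto simp: K_def real)
    then have "finite (complex_of_real ` {x \<in> {a..b}. husimi F (p + of_real x * d) = t})"
      using fin finite_subset by blast
    then show False using inf by (simp add: finite_image_iff inj_on_def)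
  qed
  moreover have "compact K" unfolding K_def by (intro compact_continuous_image continuous_intros) auto
  ultimately have "h constant_on UNIV"
    using holomorphic_compact_finite_zeros[OF hol open_UNIV connected_UNIV] by blast
  then obtain c where c: "\<And>\<zeta>. h \<zeta> = c" by (auto simp: constant_on_def)
  obtain x0 where "husimi F (p + of_real x0 * d) = t"
    using inf not_finite_existsD by blast
  then have "h (of_real x0) = 0" by (simp add: real)
  then have "h (of_real x) = 0" for x :: real using c by metis
  then have lev: "husimi F (p + of_real x * d) = t" for x :: real using real[of x] by simp
  obtain R where R: "\<And>z. t \<le> husimi F z \<Longrightarrow> cmod z \<le> R"
    using bd unfolding bounded_iff by blast
  define x where "x = (\<bar>R\<bar> + cmod p + 1) / cmod d"
  have "cmod (of_real x * d) = \<bar>R\<bar> + cmod p + 1"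
  proof -
    have "x \<ge> 0" by (simp add: x_def)
    then have "cmod (of_real x * d) = x * cmod d" by (simp only: norm_mult norm_of_real abs_of_nonneg)
    then show ?thesis using d by (simp add: x_def)
  qed
  moreover have "cmod (of_real x * d) \<le> cmod (p + of_real x * d) + cmod p"
    using norm_triangle_ineq4[of "p + of_real x * d" p] by simp
  ultimately show False using R[of "p + of_real x * d"] lev[of x] by simp
qed

lemma husimi_level_null:
  assumes F: "F holomorphic_on UNIV" and bd: "bounded {z. t \<le> husimi F z}"
  shows "{z. husimi F z = t} \<in> null_sets lebesgue"
proof -
  have "{z. husimi F z = t} \<in> null_sets lborel"
  proof (rule complex_null_set_slices)
    have "husimi F \<in> borel_measurable borel"
      by (rule borel_measurable_continuous_onI[OF husimi_continuous[OF F]])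
    then show "{z. husimi F z = t} \<in> sets borel" by measurable
    fix x :: real
    have "{y. Complex x y \<in> {z. husimi F z = t}} = (\<Union>n::nat. {y \<in> {- real n..real n}. husimi F (of_real x + of_real y * \<i>) = t})"
    proof (intro equalityI subsetI)
      fix y assume y: "y \<in> {y. Complex x y \<in> {z. husimi F z = t}}"
      obtain n :: nat where "\<bar>y\<bar> \<le> real n" using real_arch_simple by blast
      with y show "y \<in> (\<Union>n::nat. {y \<in> {- real n..real n}. husimi F (of_real x + of_real y * \<i>) = t})"
        by (auto simp: Complex_eq mult.commute abs_le_iff intro!: exI[of _ n])
    qed (auto simp: Complex_eq mult.commute)
    moreover have "countable (\<Union>n::nat. {y \<in> {- real n..real n}. husimi F (of_real x + of_real y * \<i>) = t})"
      by (rule countable_UN) (auto intro!: countable_finite husimi_level_slice_finite[OF F bd, where d=\<i>] simp del: atLeastAtMost_iff)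
    ultimately show "countable {y. Complex x y \<in> {z. husimi F z = t}}" by (simp only:)
  qed
  then show ?thesis by (simp add: null_sets_completionI)
qed

section \<open>A divergence identity on superlevel sets\<close>

text \<open>The derivative with respect to \<open>w\<close> of \<open>F w * fock_kernel z w\<close>, in the sense of Wirtinger. It is also the
  \<open>w\<close>-derivative of \<open>F w * fock_kernel z w - t * exp (pi z (cnj w)) / cnj (F w)\<close>, because the second term is
  antiholomorphic; \<open>antihol_part\<close> below is the derivative of this difference with respect to
  \<open>cnj w\<close>.\<close>
definition hol_part :: "(complex \<Rightarrow> complex) \<Rightarrow> complex \<Rightarrow> complex \<Rightarrow> complex" where
  "hol_part F z w = (deriv F w - of_real pi * cnj w * F w) * fock_kernel z w"

definition antihol_part :: "(complex \<Rightarrow> complex) \<Rightarrow> real \<Rightarrow> complex \<Rightarrow> complex \<Rightarrow> complex" where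
  "antihol_part F t z w = of_real pi * (z - w) * F w * fock_kernel z w
     + of_real t * exp (of_real pi * z * cnj w) * (cnj (deriv F w) / (cnj (F w))\<^sup>2 - of_real pi * z / cnj (F w))"

lemma fock_kernel_alt: "fock_kernel z w = exp (of_real pi * z * cnj w) * exp (- of_real pi * (w * cnj w))"
  unfolding fock_kernel_def complex_norm_square[symmetric] exp_of_real[symmetric] by simp

lemma truncation_slice_derivative:
  fixes p d :: complex and x :: real
  defines "W \<equiv> \<lambda>x::real. p + of_real x * d"
  assumes F: "F holomorphic_on UNIV" and nz: "F (W x) \<noteq> 0"
  shows "((\<lambda>x. F (W x) * fock_kernel z (W x) - of_real t * exp (of_real pi * z * cnj (W x)) / cnj (F (W x)))
     has_vector_derivative (hol_part F z (W x) * d + antihol_part F t z (W x) * cnj d)) (at x)"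
proof -
  have hW: "(W has_vector_derivative d) (at x)"
    unfolding W_def by (auto intro!: derivative_eq_intros)
  have hc: "((\<lambda>x. cnj (W x)) has_vector_derivative cnj d) (at x)"
    by (rule has_vector_derivative_cnj[OF hW])
  have dF: "(F has_field_derivative deriv F (W x)) (at (W x))"
    using F by (simp add: holomorphic_derivI)
  have hF: "((\<lambda>x. F (W x)) has_vector_derivative d * deriv F (W x)) (at x)"
    using field_vector_diff_chain_at[OF hW dF] by (simp add: comp_def)
  have hFc: "((\<lambda>x. cnj (F (W x))) has_vector_derivative cnj (d * deriv F (W x))) (at x)"
    by (rule has_vector_derivative_cnj[OF hF])
  have h1: "((\<lambda>x. exp (of_real pi * z * cnj (W x))) has_vector_derivative
      of_real pi * z * cnj d * exp (of_real pi * z * cnj (W x))) (at x)"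
    using field_vector_diff_chain_at[OF has_vector_derivative_mult_right[OF hc, of "of_real pi * z"] DERIV_exp]
    by (simp add: comp_def)
  have h2: "((\<lambda>x. exp (- of_real pi * (W x * cnj (W x)))) has_vector_derivative
      - of_real pi * (W x * cnj d + d * cnj (W x)) * exp (- of_real pi * (W x * cnj (W x)))) (at x)"
    using field_vector_diff_chain_at[OF has_vector_derivative_mult_right[OF has_vector_derivative_mult[OF hW hc], of "- of_real pi"] DERIV_exp]
    by (simp add: comp_def)
  have h3: "((\<lambda>x. inverse (cnj (F (W x)))) has_vector_derivative
      cnj (d * deriv F (W x)) * (- (inverse (cnj (F (W x))) ^ 2))) (at x)"
    using field_vector_diff_chain_at[OF hFc DERIV_inverse] nz by (simp add: comp_def power2_eq_square)
  note der = has_vector_derivative_diff[OF has_vector_derivative_mult[OF hF has_vector_derivative_mult[OF h1 h2]]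
      has_vector_derivative_mult_right[OF has_vector_derivative_mult[OF h1 h3], of "of_real t"]]
  have fn: "(\<lambda>x. F (W x) * fock_kernel z (W x) - of_real t * exp (of_real pi * z * cnj (W x)) / cnj (F (W x)))
     = (\<lambda>x. F (W x) * (exp (of_real pi * z * cnj (W x)) * exp (- of_real pi * (W x * cnj (W x))))
         - of_real t * (exp (of_real pi * z * cnj (W x)) * inverse (cnj (F (W x)))))"
    unfolding fock_kernel_alt by (simp add: divide_inverse mult.assoc)
  have inv: "1 / cnj (F (W x)) = inverse (cnj (F (W x)))" "a / (cnj (F (W x)))\<^sup>2 = a * (inverse (cnj (F (W x))))\<^sup>2" for a
    by (simp_all add: divide_inverse power_inverse)
  show ?thesis unfolding fn
    by (rule has_vector_derivative_eq_rhs[OF der])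
       (simp add: hol_part_def antihol_part_def fock_kernel_alt divide_inverse power_inverse algebra_simps)
qed

text \<open>The integrand is the derivative along the line of
  \<open>\<psi> = F * fock_kernel z * (1 - t / max u t)\<close>. This function is continuous on the whole line, vanishes
  outside \<open>U\<close>, and agrees on \<open>U\<close> with the function of \<open>truncation_slice_derivative\<close> because there
  \<open>u = F * cnj F * exp (- pi \<bar>w\<bar>\<^sup>2)\<close>. Since the line meets the boundary level finitely often in a bounded
  interval, the fundamental theorem of calculus applies.\<close>
lemma superlevel_slice_integral:
  fixes p d z :: complex
  assumes F: "F holomorphic_on UNIV" and t: "t > 0" and bd: "bounded {z. t \<le> husimi F z}" and d: "d \<noteq> 0"
  defines "U \<equiv> {w. t < husimi F w}"
  assumes int: "integrable lborel (\<lambda>x::real. indicator U (p + of_real x * d) *\<^sub>R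
     (hol_part F z (p + of_real x * d) * d + antihol_part F t z (p + of_real x * d) * cnj d))"
  shows "(\<integral>x. indicator U (p + of_real x * d) *\<^sub>R
     (hol_part F z (p + of_real x * d) * d + antihol_part F t z (p + of_real x * d) * cnj d) \<partial>lborel) = 0"
proof -
  let ?D = "\<lambda>x::real. indicator U (p + of_real x * d) *\<^sub>R
     (hol_part F z (p + of_real x * d) * d + antihol_part F t z (p + of_real x * d) * cnj d)"
  define W where "W = (\<lambda>x::real. p + of_real x * d)"
  define \<psi> where "\<psi> x = F (W x) * fock_kernel z (W x) * of_real (1 - t / max (husimi F (W x)) t)" for x
  obtain R where R: "\<And>z. t \<le> husimi F z \<Longrightarrow> cmod z \<le> R"
    using bd unfolding bounded_iff by blast
  \<comment> \<open>For \<open>\<bar>x\<bar> \<ge> L\<close> the point \<open>W x\<close> lies outside the disk of radius \<open>R\<close>, hence outside the superlevel set.\<close>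
  define L where "L = (\<bar>R\<bar> + cmod p + 1) / cmod d"
  have L0: "L \<ge> 0" by (simp add: L_def)
  have far: "husimi F (W x) < t" if "\<bar>x\<bar> \<ge> L" for x
  proof (rule ccontr)
    assume "\<not> husimi F (W x) < t"
    then have "cmod (W x) \<le> R" by (intro R) simp
    moreover have "cmod (of_real x * d) \<le> cmod (W x) + cmod p"
      using norm_triangle_ineq4[of "W x" p] by (simp add: W_def)
    moreover have "\<bar>R\<bar> + cmod p + 1 \<le> cmod (of_real x * d)"
      using that d by (simp add: L_def norm_mult divide_le_eq)
    ultimately show False by linarith
  qed
  have contW: "continuous_on A W" for A unfolding W_def by (intro continuous_intros)
  have contF: "continuous_on UNIV F" by (rule holomorphic_on_imp_continuous_on[OF F])
  have contu: "continuous_on A (\<lambda>x. husimi F (W x))" for A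
    using continuous_on_compose2[OF husimi_continuous[OF F] contW] by auto
  have cont\<psi>: "continuous_on {-L..L} \<psi>"
    unfolding \<psi>_def fock_kernel_def
    using t continuous_on_compose2[OF contF contW]
    by (intro continuous_intros contu contW) (auto simp: max_def)
  have openW: "open {x. husimi F (W x) < t}" "open {x. t < husimi F (W x)}"
    using contu[of UNIV] by (auto intro!: open_Collect_less continuous_intros)
  have fin: "finite {x \<in> {-L..L}. husimi F (W x) = t}"
    unfolding W_def by (rule husimi_level_slice_finite[OF F bd d])
  have "(?D has_integral (\<psi> L - \<psi> (- L))) {-L..L}"
  proof (rule fundamental_theorem_of_calculus_interior_strong[OF fin _ _ cont\<psi>])
    show "- L \<le> L" using L0 by simp
    fix x assume x: "x \<in> {-L<..<L} - {x \<in> {-L..L}. husimi F (W x) = t}"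
    then consider "husimi F (W x) < t" | "t < husimi F (W x)" by fastforce
    then show "(\<psi> has_vector_derivative ?D x) (at x)"
    proof cases
      case 1
      have "(\<psi> has_vector_derivative 0) (at x)"
        by (rule has_vector_derivative_transform_within_open[OF has_vector_derivative_const openW(1), of _ 0])
           (use 1 t in \<open>auto simp: \<psi>_def max_def\<close>)
      moreover have "?D x = 0" using 1 by (simp add: U_def W_def[symmetric] flip: fun_cong[OF W_def])
      ultimately show ?thesis by (simp only:)
    next
      case 2
      have nz: "F (W y) \<noteq> 0" if "t < husimi F (W y)" for y using that t by (auto simp: husimi_def)
      have der: "((\<lambda>x. F (W x) * fock_kernel z (W x) - of_real t * exp (of_real pi * z * cnj (W x)) / cnj (F (W x)))
         has_vector_derivative (hol_part F z (W x) * d + antihol_part F t z (W x) * cnj d)) (at x)"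
        using truncation_slice_derivative[OF F, of p x d] nz[OF 2] unfolding W_def by simp
      have "(\<psi> has_vector_derivative (hol_part F z (W x) * d + antihol_part F t z (W x) * cnj d)) (at x)"
      proof (rule has_vector_derivative_transform_within_open[OF der openW(2)])
        show "x \<in> {x. t < husimi F (W x)}" using 2 by simp
        fix y assume y: "y \<in> {x. t < husimi F (W x)}"
        define w where "w = W y"
        have yw: "t < husimi F w" "F w \<noteq> 0" using y nz[of y] by (auto simp: w_def)
        have "of_real (husimi F w) = F w * cnj (F w) * exp (- of_real pi * (w * cnj w))"
          unfolding complex_norm_square[symmetric] husimi_def by (simp add: exp_of_real[symmetric])
        then have "F w * fock_kernel z w / of_real (husimi F w) = exp (of_real pi * z * cnj w) / cnj (F w)"
          using yw(2) unfolding fock_kernel_alt by (simp add: divide_simps)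
        then have "F w * fock_kernel z w * of_real t / of_real (husimi F w) = of_real t * exp (of_real pi * z * cnj w) / cnj (F w)"
          by (metis (no_types) mult.commute times_divide_eq_right)
        moreover have "\<psi> y = F w * fock_kernel z w - F w * fock_kernel z w * of_real t / of_real (husimi F w)"
          using yw by (simp add: \<psi>_def w_def[symmetric] max_def algebra_simps)
        ultimately show "F (W y) * fock_kernel z (W y) - of_real t * exp (of_real pi * z * cnj (W y)) / cnj (F (W y)) = \<psi> y"
          by (simp add: w_def)
      qed
      moreover have "?D x = hol_part F z (W x) * d + antihol_part F t z (W x) * cnj d"
        using 2 by (simp add: U_def W_def)
      ultimately show ?thesis by (simp only:)
    qed
  qed
  moreover have "\<psi> L = 0" "\<psi> (- L) = 0"
    using far[of L] far[of "- L"] L0 t by (auto simp: \<psi>_def max_def)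
  ultimately have "(?D has_integral 0) {-L..L}" by simp
  then have "(?D has_integral 0) UNIV"
  proof (rule has_integral_on_superset)
    fix x assume "x \<notin> {-L..L}"
    then have "husimi F (W x) < t" by (intro far) auto
    then show "?D x = 0" by (simp add: U_def W_def)
  qed auto
  moreover have "(?D has_integral (\<integral>x. ?D x \<partial>lborel)) UNIV"
    using int by (rule has_integral_integral_lborel)
  ultimately show ?thesis using has_integral_unique by blast
qed

text \<open>Cauchy's theorem for the antiholomorphic function that \<open>F * fock_kernel z\<close> agrees with on the boundary of
  \<open>U\<close>. Integrating the slice identity over all horizontal and over all vertical lines gives \<open>g + k = 0\<close>
  and \<open>g - k = 0\<close> for the integrals \<open>g\<close> and \<open>k\<close> of the two Wirtinger derivatives.\<close>
lemma superlevel_hol_part_integral: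
  assumes F: "F holomorphic_on UNIV" and t: "t > 0" and bd: "bounded {z. t \<le> husimi F z}"
  shows "integrable lborel (\<lambda>w. indicator {w. t < husimi F w} w *\<^sub>R hol_part F z w)"
    and "(\<integral>w. indicator {w. t < husimi F w} w *\<^sub>R hol_part F z w \<partial>lborel) = 0"
proof -
  define U where "U = {w. t < husimi F w}"
  define K where "K = {w. t \<le> husimi F w}"
  have cu: "continuous_on UNIV (husimi F)" by (rule husimi_continuous[OF F])
  have K: "compact K" unfolding K_def compact_eq_bounded_closed
    using bd cu by (auto intro!: closed_Collect_le continuous_intros)
  have UK: "U \<subseteq> K" by (auto simp: U_def K_def)
  have openU: "open U" unfolding U_def using cu by (auto intro!: open_Collect_less continuous_intros)
  have nz: "F w \<noteq> 0" if "w \<in> K" for w using that t by (auto simp: K_def husimi_def)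
  have cF: "continuous_on A F" "continuous_on A (deriv F)" for A
    using continuous_on_subset[OF holomorphic_on_imp_continuous_on[OF F]]
      continuous_on_subset[OF holomorphic_on_imp_continuous_on[OF holomorphic_deriv[OF F open_UNIV]]] by auto
  have cg: "continuous_on K (hol_part F z)"
    unfolding hol_part_def fock_kernel_def by (intro continuous_intros cF)
  have ck: "continuous_on K (antihol_part F t z)"
    unfolding antihol_part_def fock_kernel_def by (intro continuous_intros cF) (auto simp: nz)
  \<comment> \<open>Functions continuous on the compact set \<open>K\<close> and cut off to \<open>U\<close> are integrable, also along lines.\<close>
  have good: "integrable lborel (\<lambda>w. indicator U w *\<^sub>R f w)
      \<and> (\<forall>p d. d \<noteq> 0 \<longrightarrow> integrable lborel (\<lambda>x::real. indicator U (p + of_real x * d) *\<^sub>R f (p + of_real x * d)))"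
    if f: "continuous_on K f" for f :: "complex \<Rightarrow> complex"
  proof -
    obtain B where B: "\<And>w. w \<in> K \<Longrightarrow> cmod (f w) \<le> B"
      using compact_imp_bounded[OF compact_continuous_image[OF f K]] unfolding bounded_iff by auto
    obtain R where R: "\<And>w. w \<in> K \<Longrightarrow> cmod w \<le> R"
      using compact_imp_bounded[OF K] unfolding bounded_iff by blast
    have m: "(\<lambda>w. indicator U w *\<^sub>R f w) \<in> borel_measurable borel"
      using openU continuous_on_subset[OF f UK] by (intro borel_measurable_continuous_on_indicator) auto
    have b: "norm (indicator U w *\<^sub>R f w) \<le> norm (B * indicator (cball 0 R) w)" for w
      using B[of w] R[of w] UK by (auto simp: indicator_def intro: order_trans[OF _ abs_ge_self])
    have 1: "integrable lborel (\<lambda>w. indicator U w *\<^sub>R f w)"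
    proof (rule Bochner_Integration.integrable_bound)
      show "integrable lborel (\<lambda>w. B * indicator (cball 0 R :: complex set) w)"
        using emeasure_bounded_finite[OF bounded_cball, of "0::complex" R]
        by (intro integrable_mult_right integrable_real_indicator) auto
      show "AE w in lborel. norm (indicator U w *\<^sub>R f w) \<le> norm (B * indicator (cball 0 R) w)"
        by (intro AE_I2 b)
    qed (use m in simp)
    have 2: "integrable lborel (\<lambda>x::real. indicator U (p + of_real x * d) *\<^sub>R f (p + of_real x * d))" if d: "d \<noteq> 0" for p d
    proof (rule Bochner_Integration.integrable_bound)
      define L where "L = (\<bar>R\<bar> + cmod p) / cmod d"
      show "integrable lborel (\<lambda>x::real. B * indicator {-L..L} x)"
        using emeasure_bounded_finite[OF bounded_closed_interval, of "-L" L]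
        by (intro integrable_mult_right integrable_real_indicator) auto
      have "(\<lambda>x::real. p + of_real x * d) \<in> borel_measurable borel" by measurable
      from measurable_compose[OF this m]
      show "(\<lambda>x::real. indicator U (p + of_real x * d) *\<^sub>R f (p + of_real x * d)) \<in> borel_measurable lborel" by simp
      have "norm (indicator U (p + of_real x * d) *\<^sub>R f (p + of_real x * d)) \<le> norm (B * indicator {-L..L} x)" for x :: real
      proof (cases "p + of_real x * d \<in> U")
        case True
        then have "p + of_real x * d \<in> K" using UK by auto
        then have c: "cmod (p + of_real x * d) \<le> R" "cmod (f (p + of_real x * d)) \<le> B" using R B by auto
        have "cmod (of_real x * d) \<le> cmod (p + of_real x * d) + cmod p"
          using norm_triangle_ineq4[of "p + of_real x * d" p] by simp
        then have "\<bar>x\<bar> \<le> L" using c d by (simp add: L_def norm_mult le_divide_eq)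
        then show ?thesis using c(2) True by (auto simp: abs_le_iff intro: order_trans[OF _ abs_ge_self])
      qed simp
      then show "AE x in lborel. norm (indicator U (p + of_real x * d) *\<^sub>R f (p + of_real x * d)) \<le> norm (B * indicator {-L..L} x)"
        by (intro AE_I2)
    qed
    show ?thesis using 1 2 by blast
  qed
  have gi: "integrable lborel (\<lambda>w. indicator U w *\<^sub>R hol_part F z w)"
   and ki: "integrable lborel (\<lambda>w. indicator U w *\<^sub>R antihol_part F t z w)"
    using good[OF cg] good[OF ck] by auto
  have comb: "continuous_on K (\<lambda>w. hol_part F z w * d + antihol_part F t z w * cnj d)" for d
    by (intro continuous_intros cg ck)
  let ?g = "\<integral>w. indicator U w *\<^sub>R hol_part F z w \<partial>lborel"
  let ?k = "\<integral>w. indicator U w *\<^sub>R antihol_part F t z w \<partial>lborel"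
  have split: "(\<integral>w. indicator U w *\<^sub>R (hol_part F z w * d + antihol_part F t z w * cnj d) \<partial>lborel) = ?g * d + ?k * cnj d" for d
  proof -
    have "(\<integral>w. indicator U w *\<^sub>R (hol_part F z w * d + antihol_part F t z w * cnj d) \<partial>lborel)
      = (\<integral>w. (indicator U w *\<^sub>R hol_part F z w) * d + (indicator U w *\<^sub>R antihol_part F t z w) * cnj d \<partial>lborel)"
      by (simp add: scaleR_add_right)
    also have "\<dots> = ?g * d + ?k * cnj d"
      by (subst Bochner_Integration.integral_add) (intro integrable_mult_left gi ki, intro integrable_mult_left gi ki, simp only: integral_mult_left_zero)
    finally show ?thesis .
  qed
  have slice: "(\<integral>x. indicator U (p + of_real x * d) *\<^sub>R (hol_part F z (p + of_real x * d) * d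
      + antihol_part F t z (p + of_real x * d) * cnj d) \<partial>lborel) = 0" if "d \<noteq> 0" for p d
    using good[OF comb[of d]] that unfolding U_def
    by (intro superlevel_slice_integral[OF F t bd that]) auto
  have "(\<integral>w. indicator U w *\<^sub>R (hol_part F z w * 1 + antihol_part F t z w * cnj 1) \<partial>lborel) = 0"
  proof -
    have "Complex x y = \<i> * of_real y + of_real x * 1" for x y by (simp add: Complex_eq)
    then show ?thesis
      using good[OF comb[of 1]] slice[of 1 "\<i> * of_real _"]
      by (subst complex_integral_slices(2)) (simp_all only: integral_zero, auto)
  qed
  then have e1: "?g + ?k = 0" unfolding split by simp
  have "(\<integral>w. indicator U w *\<^sub>R (hol_part F z w * \<i> + antihol_part F t z w * cnj \<i>) \<partial>lborel) = 0"
  proof -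
    have "Complex x y = of_real x + of_real y * \<i>" for x y by (simp add: Complex_eq)
    then show ?thesis
      using good[OF comb[of \<i>]] slice[of \<i> "of_real _"]
      by (subst complex_integral_slices(1)) (simp_all only: integral_zero, auto)
  qed
  then have "?g * \<i> + ?k * cnj \<i> = 0" unfolding split .
  then have "\<i> * (?g - ?k) = 0" by (simp add: algebra_simps)
  then have "?g = ?k" by simp
  with e1 have "?g + ?g = 0" by simp
  then show "(\<integral>w. indicator {w. t < husimi F w} w *\<^sub>R hol_part F z w \<partial>lborel) = 0"
    unfolding U_def by (simp only: mult_2[symmetric]) simp
  show "integrable lborel (\<lambda>w. indicator {w. t < husimi F w} w *\<^sub>R hol_part F z w)"
    using gi unfolding U_def .
qed

section \<open>Derivatives of extremal functions\<close>

lemma set_integral_lebesgue_borel: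
  fixes f :: "complex \<Rightarrow> 'b::{banach, second_countable_topology}"
  assumes "f \<in> borel_measurable borel" "U \<in> sets borel"
  shows "(LINT w:U|lebesgue. f w) = (\<integral>w. indicator U w *\<^sub>R f w \<partial>lborel)"
  unfolding set_lebesgue_integral_def using assms
  by (intro integral_completion borel_measurable_scaleR borel_measurable_indicator) auto

lemma indicator_bounded_integrable:
  fixes f :: "complex \<Rightarrow> 'b::{banach, second_countable_topology}"
  assumes f: "f \<in> borel_measurable borel" and U: "U \<in> sets borel" "bounded U" and B: "\<And>w. w \<in> U \<Longrightarrow> norm (f w) \<le> B"
  shows "integrable lborel (\<lambda>w. indicator U w *\<^sub>R f w)"
proof (rule Bochner_Integration.integrable_bound)
  show "integrable lborel (\<lambda>w. B * indicator U w)"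
    using emeasure_bounded_finite[OF U(2)] U(1)
    by (intro integrable_mult_right integrable_real_indicator) auto
  show "(\<lambda>w. indicator U w *\<^sub>R f w) \<in> borel_measurable lborel"
    using f U(1) by (intro borel_measurable_scaleR borel_measurable_indicator) auto
  show "AE w in lborel. norm (indicator U w *\<^sub>R f w) \<le> norm (B * indicator U w)"
  proof (rule AE_I2)
    fix w show "norm (indicator U w *\<^sub>R f w) \<le> norm (B * indicator U w)"
      using order_trans[OF B abs_ge_self, of w] by (cases "w \<in> U") auto
  qed
qed

lemma continuous_bounded_on_bounded:
  fixes f :: "complex \<Rightarrow> complex"
  assumes f: "continuous_on UNIV f" and U: "bounded U"
  obtains B where "B > 0" "\<And>w. w \<in> U \<Longrightarrow> cmod (f w) \<le> B"
proof -
  have "compact (closure U)" using U by (simp add: compact_closure)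
  then have "bounded (f ` closure U)"
    using f by (intro compact_imp_bounded compact_continuous_image) (auto intro: continuous_on_subset)
  then obtain B where "B > 0" "\<And>w. w \<in> closure U \<Longrightarrow> cmod (f w) \<le> B"
    unfolding bounded_pos by auto
  then show ?thesis using closure_subset[of U] by (intro that[of B]) auto
qed

lemma continuous_indicator_integrable:
  fixes f :: "complex \<Rightarrow> complex"
  assumes f: "continuous_on UNIV f" and U: "U \<in> sets borel" "bounded U"
  shows "integrable lborel (\<lambda>w. indicator U w *\<^sub>R f w)"
proof -
  obtain B where "\<And>w. w \<in> U \<Longrightarrow> cmod (f w) \<le> B" using continuous_bounded_on_bounded[OF f U(2)] by blast
  then show ?thesis by (rule indicator_bounded_integrable[OF borel_measurable_continuous_onI[OF f] U])
qed

text \<open>Differentiating the eigenvalue equation in \<open>z\<close> brings down the factor \<open>pi * cnj w\<close> on \<open>F w\<close>, and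
  \<open>superlevel_hol_part_integral\<close> says that this factor may be traded for the derivative of \<open>F\<close>.\<close>
lemma deriv_eigenfunction:
  assumes F: "F holomorphic_on UNIV" and t: "t > 0" and bd: "bounded {z. t \<le> husimi F z}"
    and eig: "\<And>z. of_real l * F z = (LINT w:{w. t < husimi F w}|lebesgue. F w * fock_kernel z w)"
  shows "of_real l * deriv F z = (LINT w:{w. t < husimi F w}|lebesgue. deriv F w * fock_kernel z w)"
proof -
  define U where "U = {w. t < husimi F w}"
  have cF: "continuous_on UNIV F" "continuous_on UNIV (deriv F)"
    using F by (auto intro: holomorphic_on_imp_continuous_on holomorphic_deriv)
  have cK: "continuous_on UNIV (fock_kernel z)" for z
    unfolding fock_kernel_def by (intro continuous_intros)
  have "open U" unfolding U_def using husimi_continuous[OF F] by (auto intro!: open_Collect_less continuous_intros)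
  then have Ub: "U \<in> sets borel" by simp
  have Ubd: "bounded U" by (rule bounded_subset[OF bd]) (auto simp: U_def)
  have lint: "(LINT w:U|lebesgue. f w) = (\<integral>w. indicator U w *\<^sub>R f w \<partial>lborel)" if "continuous_on UNIV f" for f :: "complex \<Rightarrow> complex"
    by (rule set_integral_lebesgue_borel[OF borel_measurable_continuous_onI[OF that] Ub])
  define k where "k w = indicator U w *\<^sub>R (F w * of_real (exp (- pi * (cmod w)\<^sup>2)))" for w
  define g where "g w = of_real pi * cnj w" for w
  have ck: "continuous_on UNIV (\<lambda>w. F w * of_real (exp (- pi * (cmod w)\<^sup>2)))"
    by (intro continuous_intros cF)
  have km: "k \<in> borel_measurable lborel" unfolding k_def
    using borel_measurable_continuous_onI[OF ck] Ub
    by (intro borel_measurable_scaleR borel_measurable_indicator) auto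
  have "g \<in> borel_measurable borel" unfolding g_def
    by (intro borel_measurable_continuous_onI continuous_intros)
  then have gm: "g \<in> borel_measurable lborel" by simp
  have int: "integrable lborel (\<lambda>w. cmod (k w) * exp (r * cmod (g w)))" for r
  proof -
    have "continuous_on UNIV (\<lambda>w. of_real (cmod (F w * of_real (exp (- pi * (cmod w)\<^sup>2))) * exp (r * cmod (of_real pi * cnj w))) :: complex)"
      by (intro continuous_intros cF)
    from integrable_norm[OF continuous_indicator_integrable[OF this Ub Ubd]]
    show ?thesis by (simp add: k_def g_def norm_mult indicator_def mult.assoc if_distrib cong: if_cong)
  qed
  have ke: "k w * exp (z * g w) = indicator U w *\<^sub>R (F w * fock_kernel z w)" for z w
    by (simp add: k_def g_def fock_kernel_def mult_ac)
  have d1: "((\<lambda>z. \<integral>w. k w * exp (z * g w) \<partial>lborel) has_field_derivative (\<integral>w. k w * g w * exp (z * g w) \<partial>lborel)) (at z)"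
    by (rule laplace_has_field_derivative[OF km gm int])
  have d2: "(\<lambda>z. \<integral>w. k w * exp (z * g w) \<partial>lborel) = (\<lambda>z. of_real l * F z)"
    unfolding ke eig U_def[symmetric] by (rule ext, rule lint[symmetric]) (intro continuous_intros cF cK)
  have d3: "((\<lambda>z. of_real l * F z) has_field_derivative of_real l * deriv F z) (at z)"
    using F by (intro DERIV_cmult) (simp add: holomorphic_derivI)
  have d: "of_real l * deriv F z = (\<integral>w. k w * g w * exp (z * g w) \<partial>lborel)"
    by (rule DERIV_unique[OF d3 d1[unfolded d2]])
  have hp: "integrable lborel (\<lambda>w. indicator U w *\<^sub>R hol_part F z w)" "(\<integral>w. indicator U w *\<^sub>R hol_part F z w \<partial>lborel) = 0"
    unfolding U_def by (rule superlevel_hol_part_integral[OF F t bd])+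
  have i2: "integrable lborel (\<lambda>w. indicator U w *\<^sub>R (of_real pi * cnj w * F w * fock_kernel z w))"
    by (rule continuous_indicator_integrable[OF _ Ub Ubd]) (intro continuous_intros cF cK)
  have "(LINT w:U|lebesgue. deriv F w * fock_kernel z w) = (\<integral>w. indicator U w *\<^sub>R (deriv F w * fock_kernel z w) \<partial>lborel)"
    by (rule lint) (intro continuous_intros cF cK)
  also have "\<dots> = (\<integral>w. indicator U w *\<^sub>R hol_part F z w + indicator U w *\<^sub>R (of_real pi * cnj w * F w * fock_kernel z w) \<partial>lborel)"
    by (intro Bochner_Integration.integral_cong refl) (simp add: hol_part_def algebra_simps)
  also have "\<dots> = (\<integral>w. indicator U w *\<^sub>R (of_real pi * cnj w * F w * fock_kernel z w) \<partial>lborel)"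
    using hp(2) by (subst Bochner_Integration.integral_add[OF hp(1) i2]) simp
  also have "\<dots> = (\<integral>w. k w * g w * exp (z * g w) \<partial>lborel)"
    by (intro Bochner_Integration.integral_cong refl) (simp add: k_def g_def fock_kernel_def mult_ac)
  finally show ?thesis using d unfolding U_def by simp
qed

section \<open>Superposition of coherent states\<close>

lemma coherent_bound:
  "cmod (coherent z t) \<le> 2 * exp (pi * (cmod z)\<^sup>2 / 2) * exp (2 * pi * cmod z * \<bar>t\<bar> - pi * t\<^sup>2)"
proof -
  have "(2::real) powr (1/4) \<le> 2 powr 1" by (rule powr_mono) auto
  then have 1: "(2::real) powr (1/4) \<le> 2" by simp
  have "t * Re z \<le> \<bar>t\<bar> * cmod z"
  proof -
    have "t * Re z \<le> \<bar>t\<bar> * \<bar>Re z\<bar>" by (simp only: abs_mult[symmetric] abs_ge_self)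
    also have "\<dots> \<le> \<bar>t\<bar> * cmod z" by (intro mult_left_mono abs_Re_le_cmod) simp
    finally show ?thesis .
  qed
  moreover have "- Re (z\<^sup>2) \<le> (cmod z)\<^sup>2"
    using abs_Re_le_cmod[of "z\<^sup>2"] by (simp add: norm_power)
  moreover have "Re (2 * of_real t * z - of_real t ^ 2 - z\<^sup>2 / 2) = 2 * (t * Re z) - t\<^sup>2 - Re (z\<^sup>2) / 2"
    by (simp flip: of_real_power)
  ultimately have "Re (2 * of_real t * z - of_real t ^ 2 - z\<^sup>2 / 2) \<le> (cmod z)\<^sup>2 / 2 + 2 * cmod z * \<bar>t\<bar> - t\<^sup>2"
    by (simp add: mult.commute mult.left_commute)
  then have "pi * Re (2 * of_real t * z - of_real t ^ 2 - z\<^sup>2 / 2) \<le> pi * ((cmod z)\<^sup>2 / 2 + 2 * cmod z * \<bar>t\<bar> - t\<^sup>2)"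
    by (rule mult_left_mono) simp
  then have 2: "exp (Re (of_real pi * (2 * of_real t * z - of_real t ^ 2 - z\<^sup>2 / 2)))
     \<le> exp (pi * (cmod z)\<^sup>2 / 2 + (2 * pi * cmod z * \<bar>t\<bar> - pi * t\<^sup>2))"
    by (subst exp_le_cancel_iff) (simp add: algebra_simps)
  have "cmod (coherent z t) = 2 powr (1/4) * exp (Re (of_real pi * (2 * of_real t * z - of_real t ^ 2 - z\<^sup>2 / 2)))"
    unfolding coherent_def norm_mult norm_exp_eq_Re by simp
  also have "\<dots> \<le> 2 * exp (pi * (cmod z)\<^sup>2 / 2 + (2 * pi * cmod z * \<bar>t\<bar> - pi * t\<^sup>2))"
    by (rule mult_mono[OF 1 2]) auto
  finally show ?thesis by (simp add: exp_add mult.assoc)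
qed

text \<open>The adjoint of the Bargmann transform: superposing conjugated coherent states with density \<open>\<Phi>\<close> yields
  a vector \<open>g\<close>, and Fubini's theorem with \<open>coherent_inner\<close> computes its transform and its norm. Boundedness
  and compact support of \<open>\<Phi>\<close> give \<open>g\<close> Gaussian decay, so that all integrals converge absolutely.\<close>
lemma synthesis:
  fixes \<Phi> :: "complex \<Rightarrow> complex"
  assumes \<Phi>: "\<Phi> \<in> borel_measurable borel" and M: "\<And>w. cmod (\<Phi> w) \<le> M" and supp: "\<And>w. w \<notin> cball 0 R \<Longrightarrow> \<Phi> w = 0"
  obtains g where "g \<in> L2" 
    "\<And>z. bargmann g z = (\<integral>w. \<Phi> w * exp (of_real pi * z * cnj w) \<partial>lborel)"
    "of_real ((L2_norm g)\<^sup>2) = (\<integral>w. cnj (\<Phi> w) * bargmann g w \<partial>lborel)"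
proof -
  define g where "g t = (\<integral>w. \<Phi> w * cnj (coherent w t) \<partial>lborel)" for t
  \<comment> \<open>Coherent states with \<open>\<bar>w\<bar> \<le> R\<close> are bounded by \<open>A * e R\<close>, and products of two functions \<open>e\<close> are integrable.\<close>
  define e where "e r t = exp (2 * pi * r * \<bar>t\<bar> - pi * t\<^sup>2)" for r t :: real
  define A where "A = 2 * exp (pi * R\<^sup>2 / 2)"
  define v where "v = (\<integral>w. (indicator (cball 0 R :: complex set) w :: real) \<partial>lborel)"
  have M0: "0 \<le> M" using M[of 0] norm_ge_zero order_trans by blast
  have ee: "e r t * e s t = exp (- 2 * pi * t\<^sup>2 + 2 * pi * (r + s) * \<bar>t\<bar>)" for r s t
    unfolding e_def exp_add[symmetric] by (rule arg_cong[where f=exp]) (simp add: algebra_simps)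
  have eint: "integrable lborel (\<lambda>t. e r t * e s t)" for r s
    unfolding ee by (rule gaussian_abs_integrable)
  have emeas: "e r \<in> borel_measurable borel" for r unfolding e_def by measurable
  have ind: "integrable lborel (\<lambda>w. indicator (cball 0 R :: complex set) w :: real)"
    using emeasure_bounded_finite[OF bounded_cball, of "0::complex" R] by (intro integrable_real_indicator) auto
  have m2: "(\<lambda>p. coherent (snd p) (fst p)) \<in> borel_measurable (lborel \<Otimes>\<^sub>M lborel)"
    unfolding coherent_def by measurable
  have bound: "cmod (\<Phi> w) * cmod (coherent w t) \<le> (A * M) * (e R t * indicator (cball 0 R) w)" for w t
  proof (cases "w \<in> cball 0 R")
    case True
    then have wR: "cmod w \<le> R" by simp
    have "cmod (coherent w t) \<le> 2 * exp (pi * (cmod w)\<^sup>2 / 2) * exp (2 * pi * cmod w * \<bar>t\<bar> - pi * t\<^sup>2)" by (rule coherent_bound)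
    also have "\<dots> \<le> A * e R t"
      unfolding A_def e_def using wR by (intro mult_mono) (auto intro!: mult_right_mono mult_left_mono power_mono)
    finally have "cmod (\<Phi> w) * cmod (coherent w t) \<le> M * (A * e R t)"
      using M[of w] M0 by (intro mult_mono) auto
    then show ?thesis using True by (simp add: mult_ac)
  qed (use supp in simp)
  have gb: "cmod (g t) \<le> (A * M * v) * e R t" for t
  proof -
    have "cmod (g t) \<le> (\<integral>w. (A * M) * (e R t * indicator (cball 0 R :: complex set) w) \<partial>lborel)"
      unfolding g_def
    proof (rule order_trans[OF integral_norm_bound], rule integral_mono)
      show "integrable lborel (\<lambda>w. A * M * (e R t * indicat_real (cball 0 R :: complex set) w))"
        by (intro integrable_mult_right ind)
      then show "integrable lborel (\<lambda>w. cmod (\<Phi> w * cnj (coherent w t)))"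
      proof (rule Bochner_Integration.integrable_bound)
        have "(\<lambda>w. coherent w t) \<in> borel_measurable borel" unfolding coherent_def by measurable
        then have "(\<lambda>w. cmod (\<Phi> w) * cmod (coherent w t)) \<in> borel_measurable lborel" using \<Phi> by measurable
        then show "(\<lambda>w. cmod (\<Phi> w * cnj (coherent w t))) \<in> borel_measurable lborel" by (simp add: norm_mult)
        show "AE w in lborel. norm (cmod (\<Phi> w * cnj (coherent w t))) \<le> norm (A * M * (e R t * indicat_real (cball 0 R) w))"
          using order_trans[OF bound abs_ge_self] by (intro AE_I2) (simp add: norm_mult)
      qed
      show "cmod (\<Phi> w * cnj (coherent w t)) \<le> A * M * (e R t * indicat_real (cball 0 R) w)" for w
        using bound[of w t] by (simp add: norm_mult)
    qed
    also have "\<dots> = (A * M * v) * e R t" by (simp add: v_def mult_ac)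
    finally show ?thesis .
  qed
  have gm: "g \<in> borel_measurable borel"
  proof -
    have "(\<lambda>p. \<Phi> (snd p) * cnj (coherent (snd p) (fst p))) \<in> borel_measurable (lborel \<Otimes>\<^sub>M lborel)"
      using m2 \<Phi> by (intro borel_measurable_times measurable_compose[OF m2 borel_measurable_continuous_onI[OF continuous_on_cnj[OF continuous_on_id]]]) auto
    then have "(\<lambda>(t, w). \<Phi> w * cnj (coherent w t)) \<in> borel_measurable (lborel \<Otimes>\<^sub>M lborel)" by (simp add: case_prod_beta')
    from lborel.borel_measurable_lebesgue_integral[OF this] show ?thesis unfolding g_def by simp
  qed
  have gL2: "g \<in> L2"
  proof -
    have "integrable lborel (\<lambda>t. (cmod (g t))\<^sup>2)"
    proof (rule Bochner_Integration.integrable_bound)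
      show "integrable lborel (\<lambda>t. (A * M * v)\<^sup>2 * (e R t * e R t))" by (intro integrable_mult_right eint)
      show "(\<lambda>t. (cmod (g t))\<^sup>2) \<in> borel_measurable lborel" using gm by measurable
      have "(cmod (g t))\<^sup>2 \<le> ((A * M * v) * e R t)\<^sup>2" for t by (intro power_mono gb) simp
      moreover have "((A * M * v) * e R t)\<^sup>2 = (A * M * v)\<^sup>2 * (e R t * e R t)" for t
        by (simp only: power2_eq_square mult_ac)
      ultimately have "(cmod (g t))\<^sup>2 \<le> (A * M * v)\<^sup>2 * (e R t * e R t)" for t by (simp only:)
      then show "AE t in lborel. norm ((cmod (g t))\<^sup>2) \<le> norm ((A * M * v)\<^sup>2 * (e R t * e R t))"
        by (intro AE_I2) (simp only: real_norm_def abs_power2, rule order_trans[OF _ abs_ge_self])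
    qed
    moreover have "g \<in> borel_measurable lebesgue" by (rule measurable_completion) (use gm in simp)
    moreover have "(\<lambda>t. (cmod (g t))\<^sup>2) \<in> borel_measurable lborel" using gm by measurable
    ultimately show ?thesis unfolding L2_def by (simp add: integrable_completion)
  qed
  \<comment> \<open>The adjoint relation; it is applied to a conjugated coherent state, which gives the transform of \<open>g\<close>, and to \<open>g\<close> itself, which gives the norm.\<close>
  have fub: "(\<integral>t. f t * cnj (g t) \<partial>lborel) = (\<integral>w. cnj (\<Phi> w) * (\<integral>t. f t * coherent w t \<partial>lborel) \<partial>lborel)"
    if fm: "f \<in> borel_measurable borel" and fb: "\<And>t. cmod (f t) \<le> C * e r t" for f C r
  proof -
    let ?h = "\<lambda>p. f (fst p) * (cnj (\<Phi> (snd p)) * coherent (snd p) (fst p))"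
    have hi: "integrable (lborel \<Otimes>\<^sub>M lborel) ?h"
    proof (rule Bochner_Integration.integrable_bound)
      show "integrable (lborel \<Otimes>\<^sub>M lborel) (\<lambda>p. (C * (A * M)) * ((e r (fst p) * e R (fst p)) * indicator (cball 0 R :: complex set) (snd p)))"
      proof (intro integrable_mult_right, rule lborel_pair.Fubini_integrable)
        show "(\<lambda>p. e r (fst p) * e R (fst p) * indicat_real (cball 0 R :: complex set) (snd p)) \<in> borel_measurable (lborel \<Otimes>\<^sub>M lborel)"
        proof -
          have gen: "(\<lambda>p. a (fst p) * b (fst p) * c (snd p)) \<in> borel_measurable (lborel \<Otimes>\<^sub>M lborel)"
            if [measurable]: "a \<in> borel_measurable borel" "b \<in> borel_measurable borel" "c \<in> borel_measurable borel"
            for a b :: "real \<Rightarrow> real" and c :: "complex \<Rightarrow> real"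
            by measurable
          show ?thesis by (rule gen[OF emeas emeas borel_measurable_indicator]) simp
        qed
        have "(\<integral>w. norm (e r (fst (t, w)) * e R (fst (t, w)) * indicat_real (cball 0 R :: complex set) (snd (t, w))) \<partial>lborel) = (e r t * e R t) * v" for t
          by (simp add: v_def abs_mult e_def)
        then show "integrable lborel (\<lambda>t. \<integral>w. norm (e r (fst (t, w)) * e R (fst (t, w)) * indicat_real (cball 0 R :: complex set) (snd (t, w))) \<partial>lborel)"
          by (simp only:) (intro integrable_mult_left eint)
        show "AE t in lborel. integrable lborel (\<lambda>w. e r (fst (t, w)) * e R (fst (t, w)) * indicat_real (cball 0 R :: complex set) (snd (t, w)))"
          by (intro AE_I2) (simp only: fst_conv snd_conv, intro integrable_mult_right ind)
      qed
      have cm: "cnj \<in> borel_measurable borel" by (rule borel_measurable_continuous_onI[OF continuous_on_cnj[OF continuous_on_id]])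
      have "(\<lambda>p. cnj (\<Phi> (snd p))) \<in> borel_measurable (lborel \<Otimes>\<^sub>M lborel)"
        using \<Phi> cm by measurable
      moreover have "(\<lambda>p. f (fst p)) \<in> borel_measurable (lborel \<Otimes>\<^sub>M lborel)" using fm by measurable
      ultimately show "?h \<in> borel_measurable (lborel \<Otimes>\<^sub>M lborel)"
        using m2 by (intro borel_measurable_times)
      have hb: "cmod (f t * (cnj (\<Phi> w) * coherent w t)) \<le> (C * (A * M)) * ((e r t * e R t) * indicator (cball 0 R) w)" for t w
      proof -
        have "cmod (f t) * (cmod (\<Phi> w) * cmod (coherent w t)) \<le> (C * e r t) * ((A * M) * (e R t * indicator (cball 0 R) w))"
          using fb[of t] bound[of w t] order_trans[OF norm_ge_zero fb[of t]] by (intro mult_mono[OF fb bound]) auto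
        then show ?thesis by (simp add: norm_mult mult_ac)
      qed
      show "AE p in lborel \<Otimes>\<^sub>M lborel. norm (?h p) \<le> norm ((C * (A * M)) * ((e r (fst p) * e R (fst p)) * indicat_real (cball 0 R) (snd p)))"
      proof (rule AE_I2)
        fix p
        show "norm (?h p) \<le> norm ((C * (A * M)) * ((e r (fst p) * e R (fst p)) * indicat_real (cball 0 R) (snd p)))"
          using order_trans[OF hb[of "fst p" "snd p"] abs_ge_self] by (simp only: real_norm_def)
      qed
    qed
    have cg: "cnj (g t) = (\<integral>w. cnj (\<Phi> w) * coherent w t \<partial>lborel)" for t
      unfolding g_def Bochner_Integration.integral_cnj[symmetric] by simp
    have "(\<integral>t. f t * cnj (g t) \<partial>lborel) = (\<integral>t. (\<integral>w. f t * (cnj (\<Phi> w) * coherent w t) \<partial>lborel) \<partial>lborel)"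
      unfolding cg by simp
    also have "\<dots> = (\<integral>w. (\<integral>t. f t * (cnj (\<Phi> w) * coherent w t) \<partial>lborel) \<partial>lborel)"
      using lborel_pair.Fubini_integral[of "\<lambda>t w. f t * (cnj (\<Phi> w) * coherent w t)"] hi by (simp add: case_prod_beta')
    also have "\<dots> = (\<integral>w. cnj (\<Phi> w) * (\<integral>t. f t * coherent w t \<partial>lborel) \<partial>lborel)"
      by (simp only: mult.left_commute[of "f _"] integral_mult_right_zero)
    finally show ?thesis .
  qed
  have cmeas: "cnj \<in> borel_measurable borel" by (rule borel_measurable_continuous_onI[OF continuous_on_cnj[OF continuous_on_id]])
  have bg: "bargmann g z = (\<integral>t. g t * coherent z t \<partial>lborel)" for z
    unfolding bargmann_def using gm by (intro integral_completion) simp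
  show ?thesis
  proof (rule that[OF gL2])
    fix z
    have "cnj (bargmann g z) = (\<integral>t. cnj (coherent z t) * cnj (g t) \<partial>lborel)"
      unfolding bg Bochner_Integration.integral_cnj[symmetric] by (simp add: mult.commute)
    also have "\<dots> = (\<integral>w. cnj (\<Phi> w) * (\<integral>t. cnj (coherent z t) * coherent w t \<partial>lborel) \<partial>lborel)"
    proof (rule fub)
      show "(\<lambda>t. cnj (coherent z t)) \<in> borel_measurable borel" using cmeas by measurable
      show "cmod (cnj (coherent z t)) \<le> 2 * exp (pi * (cmod z)\<^sup>2 / 2) * e (cmod z) t" for t
        using coherent_bound[of z t] by (simp add: e_def)
    qed
    also have "\<dots> = (\<integral>w. cnj (\<Phi> w * exp (of_real pi * z * cnj w)) \<partial>lborel)"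
    proof -
      have "(\<integral>t. cnj (coherent z t) * coherent w t \<partial>lborel) = exp (of_real pi * w * cnj z)" for w
        using coherent_inner[of w z] by (simp add: has_bochner_integral_iff mult.commute)
      moreover have "cnj (\<Phi> w) * exp (of_real pi * w * cnj z) = cnj (\<Phi> w * exp (of_real pi * z * cnj w))" for w
        by (simp add: exp_cnj mult_ac)
      ultimately show ?thesis by (simp only:)
    qed
    also have "\<dots> = cnj (\<integral>w. \<Phi> w * exp (of_real pi * z * cnj w) \<partial>lborel)"
      by (rule Bochner_Integration.integral_cnj)
    finally show "bargmann g z = (\<integral>w. \<Phi> w * exp (of_real pi * z * cnj w) \<partial>lborel)" by simp
  next
    have "of_real ((L2_norm g)\<^sup>2) = (\<integral>t. g t * cnj (g t) \<partial>lborel)"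
    proof -
      have "(L2_norm g)\<^sup>2 = (\<integral>t. (cmod (g t))\<^sup>2 \<partial>lborel)"
        unfolding L2_norm_sq using gm by (intro integral_completion) simp
      then have "of_real ((L2_norm g)\<^sup>2) = (\<integral>t. complex_of_real ((cmod (g t))\<^sup>2) \<partial>lborel)"
        by (simp only: integral_complex_of_real)
      then show ?thesis by (simp only: complex_norm_square)
    qed
    also have "\<dots> = (\<integral>w. cnj (\<Phi> w) * bargmann g w \<partial>lborel)" unfolding bg by (rule fub[OF gm gb])
    finally show "of_real ((L2_norm g)\<^sup>2) = (\<integral>w. cnj (\<Phi> w) * bargmann g w \<partial>lborel)" .
  qed
qed

section \<open>Local maximizers are disks\<close>

text \<open>Superpose conjugated coherent states with density \<open>G w * exp (- pi \<bar>w\<bar>\<^sup>2)\<close> on \<open>U\<close>; by the eigenvalue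
  equation the transform of the result is again \<open>G\<close>, up to the factor \<open>l\<close>.\<close>
lemma eigenfunction_is_bargmann:
  assumes G: "G holomorphic_on UNIV" and U: "U \<in> sets borel" "bounded U"
    and eig: "\<And>z. of_real l * G z = (LINT w:U|lebesgue. G w * fock_kernel z w)"
  obtains g where "g \<in> L2" "\<And>z. bargmann g z = of_real l * G z"
    "(L2_norm g)\<^sup>2 = l * (LINT z:U|lebesgue. husimi G z)"
proof -
  define \<phi> where "\<phi> w = G w * of_real (exp (- pi * (cmod w)\<^sup>2))" for w
  define \<Phi> where "\<Phi> w = indicator U w *\<^sub>R \<phi> w" for w
  have cG: "continuous_on UNIV G" by (rule holomorphic_on_imp_continuous_on[OF G])
  have c\<phi>: "continuous_on UNIV \<phi>" unfolding \<phi>_def by (intro continuous_intros cG)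
  obtain M where M: "M > 0" "\<And>w. w \<in> U \<Longrightarrow> cmod (\<phi> w) \<le> M"
    using continuous_bounded_on_bounded[OF c\<phi> U(2)] by blast
  obtain R where R: "\<And>w. w \<in> U \<Longrightarrow> cmod w \<le> R" using U(2) unfolding bounded_iff by blast
  have \<Phi>m: "\<Phi> \<in> borel_measurable borel" unfolding \<Phi>_def
    using borel_measurable_continuous_onI[OF c\<phi>] U(1)
    by (intro borel_measurable_scaleR borel_measurable_indicator) auto
  have \<Phi>M: "cmod (\<Phi> w) \<le> M" for w using M by (simp add: \<Phi>_def indicator_def)
  have \<Phi>R: "\<Phi> w = 0" if "w \<notin> cball 0 R" for w using R[of w] that by (auto simp: \<Phi>_def indicator_def)
  obtain g where g: "g \<in> L2" "\<And>z. bargmann g z = (\<integral>w. \<Phi> w * exp (of_real pi * z * cnj w) \<partial>lborel)"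
    "of_real ((L2_norm g)\<^sup>2) = (\<integral>w. cnj (\<Phi> w) * bargmann g w \<partial>lborel)"
    using synthesis[OF \<Phi>m \<Phi>M \<Phi>R] by blast
  have cK: "continuous_on UNIV (\<lambda>w. G w * fock_kernel z w)" for z
    unfolding fock_kernel_def by (intro continuous_intros cG)
  have bg: "bargmann g z = of_real l * G z" for z
  proof -
    have "\<Phi> w * exp (of_real pi * z * cnj w) = indicator U w *\<^sub>R (G w * fock_kernel z w)" for w
      by (simp add: \<Phi>_def \<phi>_def fock_kernel_def mult_ac)
    then show ?thesis
      unfolding g(2) eig set_integral_lebesgue_borel[OF borel_measurable_continuous_onI[OF cK] U(1)] by (simp only:)
  qed
  have "cnj (\<Phi> w) * bargmann g w = of_real (l * (indicator U w *\<^sub>R husimi G w))" for w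
    unfolding bg \<Phi>_def \<phi>_def husimi_def using complex_norm_square[of "G w"]
    by (simp add: indicator_def mult_ac)
  then have "of_real ((L2_norm g)\<^sup>2) = complex_of_real (l * (\<integral>w. indicator U w *\<^sub>R husimi G w \<partial>lborel))"
    unfolding g(3) by (simp only: integral_complex_of_real integral_mult_right_zero)
  then have "(L2_norm g)\<^sup>2 = l * (LINT z:U|lebesgue. husimi G z)"
    unfolding set_integral_lebesgue_borel[OF borel_measurable_continuous_onI[OF husimi_continuous[OF G]] U(1)]
    by (simp only: of_real_eq_iff)
  then show ?thesis by (rule that[OF g(1) bg])
qed

lemma husimi_zeros_null:
  assumes F: "F holomorphic_on UNIV" and nz: "F w \<noteq> 0"
  shows "{z. husimi F z = 0} \<in> null_sets lebesgue"
proof -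
  have eq: "{z. husimi F z = 0} = {z \<in> UNIV. F z = 0}" by (auto simp: husimi_def)
  have "countable {z \<in> UNIV. F z = 0}"
  proof (cases "F constant_on UNIV")
    case True
    then have "{z \<in> UNIV. F z = 0} = {}" using nz by (auto simp: constant_on_def)
    then show ?thesis by simp
  next
    case False
    then show ?thesis
      by (intro holomorphic_countable_zeros[OF F]) auto
  qed
  then have "{z. husimi F z = 0} \<in> null_sets lborel" unfolding eq by (rule countable_imp_null_set_lborel)
  then show ?thesis by (rule null_sets_completionI)
qed

text \<open>The Gaussian window itself has an everywhere positive density.\<close>
lemma lambda1_pos:
  assumes \<Omega>: "\<Omega> \<in> lmeasurable" "\<Omega> \<notin> null_sets lebesgue"
  shows "0 < lambda1 gauss_window \<Omega>"
proof -
  define f where "f = (\<lambda>t. cnj (coherent 0 t))"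
  have f: "f \<in> L2" "(L2_norm f)\<^sup>2 = 1"
    unfolding f_def by (auto simp: L2_cnj coherent_L2 L2_norm_cnj L2_norm_coherent)
  have "0 < (LINT z:\<Omega>|lebesgue. husimi (bargmann f) z)"
  proof (rule set_integral_positive[OF \<Omega> husimi_set_integrable[OF \<Omega>(1) bargmann_holomorphic[OF f(1)]]])
    show "husimi (bargmann f) z \<le> 1" for z using husimi_bargmann_le[OF f(1), of z] f(2) by simp
    show "0 < husimi (bargmann f) z" for z by (simp add: husimi_def f_def bargmann_cnj_coherent)
  qed
  also have "\<dots> \<le> lambda1 gauss_window \<Omega>"
    using husimi_mass_le_lambda1[OF \<Omega>(1) f(1)] f(2) by simp
  finally show ?thesis .
qed

text \<open>Completing the square, the density is a Gaussian centered at \<open>cnj c / pi\<close>.\<close>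
lemma exponential_superlevel_ball:
  assumes F: "\<And>z. F z = A * exp (c * z)" and t: "t > 0" and ne: "{w. t < husimi F w} \<noteq> {}"
  obtains b r where "r > 0" "{w. t < husimi F w} = ball b r"
proof -
  define b where "b = cnj c / of_real pi"
  define K where "K = (cmod A)\<^sup>2 * exp (pi * (cmod b)\<^sup>2)"
  have hus: "husimi F w = K * exp (- pi * (cmod (w - b))\<^sup>2)" for w
  proof -
    have c: "c = of_real pi * cnj b" by (simp add: b_def)
    have "(cmod (exp (c * w)))\<^sup>2 * exp (- pi * (cmod w)\<^sup>2) = exp (pi * (cmod b)\<^sup>2) * exp (- pi * (cmod (w - b))\<^sup>2)"
      unfolding norm_exp_eq_Re power2_eq_square[of "exp _"] exp_add[symmetric] c cmod_power2
      by (rule arg_cong[where f=exp]) (simp add: power2_eq_square algebra_simps)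
    then show ?thesis by (simp add: husimi_def F K_def norm_mult power_mult_distrib mult.assoc)
  qed
  obtain w0 where "t < husimi F w0" using ne by auto
  then have "K \<noteq> 0" using t unfolding hus by auto
  moreover have "K \<ge> 0" by (simp add: K_def)
  ultimately have K: "K > 0" by simp
  define \<rho> where "\<rho> = ln (K / t) / pi"
  have iff: "t < husimi F w \<longleftrightarrow> (cmod (w - b))\<^sup>2 < \<rho>" for w
  proof -
    have "t < husimi F w \<longleftrightarrow> exp (pi * (cmod (w - b))\<^sup>2) < K / t"
      unfolding hus using t by (simp add: exp_minus field_simps)
    also have "\<dots> \<longleftrightarrow> pi * (cmod (w - b))\<^sup>2 < ln (K / t)"
      using K t by (metis divide_pos_pos exp_ln exp_less_cancel_iff)
    also have "\<dots> \<longleftrightarrow> (cmod (w - b))\<^sup>2 < \<rho>" by (simp add: \<rho>_def pos_less_divide_eq mult.commute)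
    finally show ?thesis .
  qed
  have \<rho>: "\<rho> > 0" using iff[of w0] \<open>t < husimi F w0\<close> zero_le_power2[of "cmod (w0 - b)"] by linarith
  have "y\<^sup>2 < \<rho> \<longleftrightarrow> y < sqrt \<rho>" if "y \<ge> 0" for y
    using real_sqrt_less_iff[of "y\<^sup>2" \<rho>] that by simp
  then have "{w. t < husimi F w} = ball b (sqrt \<rho>)"
    unfolding iff by (auto simp: dist_norm norm_minus_commute)
  then show ?thesis using that[of "sqrt \<rho>" b] \<rho> by simp
qed

theorem theorem5:
  fixes a :: real and S :: "complex set"
  assumes "a > 0"
    and "local_maximizer a S"
  shows "\<exists>a\<^sub>0::complex.
    sym_diff S ((\<lambda>z. z + a\<^sub>0) ` ball 0 (sqrt (a / pi))) \<in> null_sets lebesgue"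
proof -
  note a = \<open>a > 0\<close>
  have S: "S \<in> sets_of_measure a" using assms(2) by (simp add: local_maximizer_def)
  obtain \<delta> where \<delta>: "\<delta> > 0" and max: "\<And>E. E \<in> sets_of_measure a \<Longrightarrow> d_w S E < \<delta> \<Longrightarrow>
      lambda1 gauss_window E \<le> lambda1 gauss_window S"
    using assms(2) unfolding local_maximizer_def by auto
  have Sm: "S \<in> lmeasurable" "measure lebesgue S = a" using S a by (auto simp: sets_of_measure_iff)
  have Snn: "S \<notin> null_sets lebesgue" using Sm a by (auto dest: measure_eq_0_null_sets)
  define l where "l = lambda1 gauss_window S"
  have l: "l > 0" unfolding l_def by (rule lambda1_pos[OF Sm(1) Snn])
  obtain F where F: "F holomorphic_on UNIV" "\<And>z. husimi F z \<le> 1"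
    and mass: "(LINT z:S|lebesgue. husimi F z) = l"
    and massE: "\<And>E. E \<in> lmeasurable \<Longrightarrow> (LINT z:E|lebesgue. husimi F z) \<le> lambda1 gauss_window E"
    and eigS: "\<And>z. of_real l * F z = (LINT w:S|lebesgue. F w * fock_kernel z w)"
    using maximizer_exists[OF Sm(1)] unfolding l_def by metis
  have nz: "\<exists>w. F w \<noteq> 0"
  proof (rule ccontr)
    assume "\<nexists>w. F w \<noteq> 0"
    then have "husimi F z = 0" for z by (simp add: husimi_def)
    then show False using mass l by simp
  qed
  have optF: "(LINT z:E|lebesgue. husimi F z) \<le> (LINT z:S|lebesgue. husimi F z)"
    if "E \<in> sets_of_measure a" "d_w S E < \<delta>" for E
    using massE[of E] max[OF that] that a unfolding mass l_def by (simp add: sets_of_measure_iff)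
  obtain t where t: "t > 0" and above: "{z. husimi F z > t} - S \<in> null_sets lebesgue"
    and below: "S - {z. husimi F z \<ge> t} \<in> null_sets lebesgue"
    using nz local_bathtub[OF a S \<delta> husimi_continuous[OF F(1)] husimi_nonneg F(2) optF] husimi_zeros_null[OF F(1)]
    by blast
  define U where "U = {w. t < husimi F w}"
  have bd: "bounded {z. t \<le> husimi F z}"
    by (rule husimi_superlevel_bounded[OF Sm(1) F l eigS t])
  have openU: "open U" unfolding U_def using husimi_continuous[OF F(1)]
    by (auto intro!: open_Collect_less continuous_intros)
  have Ub: "U \<in> sets borel" "bounded U" "U \<in> sets lebesgue"
  proof -
    have "U \<subseteq> {z. t \<le> husimi F z}" by (auto simp: U_def)
    then show "bounded U" by (rule bounded_subset[OF bd])
  qed (use openU in auto)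
  have "S - U \<subseteq> (S - {z. husimi F z \<ge> t}) \<union> {z. husimi F z = t}" by (auto simp: U_def)
  moreover have "(S - {z. husimi F z \<ge> t}) \<union> {z. husimi F z = t} \<in> null_sets lebesgue"
    by (rule null_sets.Un[OF below husimi_level_null[OF F(1) bd]])
  moreover have "S - U \<in> sets lebesgue" using Sm(1) Ub(3) by (intro sets.Diff) (auto simp: fmeasurableD)
  ultimately have SU: "S - U \<in> null_sets lebesgue" by (metis null_sets_subset)
  have US: "U - S \<in> null_sets lebesgue" using above unfolding U_def .
  have null: "sym_diff S U \<in> null_sets lebesgue" by (rule null_sets.Un[OF SU US])
  have ae: "AE z in lebesgue. z \<in> S \<longleftrightarrow> z \<in> U"
    by (rule AE_I'[OF null]) auto
  have Ue: "emeasure lebesgue U = ennreal a"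
    using emeasure_eq_AE[OF ae] Sm Ub S by (auto simp: fmeasurableD sets_of_measure_def)
  have lintSU: "(LINT z:S|lebesgue. f z) = (LINT z:U|lebesgue. f z)"
    if "f \<in> borel_measurable borel" for f :: "complex \<Rightarrow> 'b::{banach, second_countable_topology}"
  proof (rule set_integral_cong_set)
    have "f \<in> borel_measurable lebesgue" by (rule measurable_completion) (use that in simp)
    then show "set_borel_measurable lebesgue S f" "set_borel_measurable lebesgue U f"
      unfolding set_borel_measurable_def using Sm Ub
      by (auto intro!: borel_measurable_scaleR borel_measurable_indicator simp: fmeasurableD)
  qed (use ae in auto)
  have cF: "continuous_on UNIV F" "continuous_on UNIV (deriv F)"
    using F(1) by (auto intro: holomorphic_on_imp_continuous_on holomorphic_deriv)
  have cK: "continuous_on UNIV (fock_kernel z)" for z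
    unfolding fock_kernel_def by (intro continuous_intros)
  have eigU: "of_real l * F z = (LINT w:U|lebesgue. F w * fock_kernel z w)" for z
    unfolding eigS by (rule lintSU) (intro borel_measurable_continuous_onI continuous_intros cF cK)
  have eigD: "of_real l * deriv F z = (LINT w:U|lebesgue. deriv F w * fock_kernel z w)" for z
    using deriv_eigenfunction[OF F(1) t bd eigU[unfolded U_def]] unfolding U_def .
  have "U \<noteq> {}" using Ue a by auto
  then obtain z0 where z0: "z0 \<in> U" by blast
  then have F0: "F z0 \<noteq> 0" using t by (auto simp: U_def husimi_def)
  \<comment> \<open>The multiple of \<open>F\<close> that makes \<open>F' - c F\<close> vanish at \<open>z0\<close>.\<close>
  define c where "c = deriv F z0 / F z0"
  define G where "G z = deriv F z - c * F z" for z
  have G: "G holomorphic_on UNIV" unfolding G_def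
    using F(1) by (intro holomorphic_intros holomorphic_deriv) auto
  have Gz0: "G z0 = 0" using F0 by (simp add: G_def c_def)
  have Ulm: "U \<in> lmeasurable" using Ub Ue by (auto simp: fmeasurable_def)
  have eigG: "of_real l * G z = (LINT w:U|lebesgue. G w * fock_kernel z w)" for z
  proof -
    have int: "set_integrable lebesgue U (\<lambda>w. f w * fock_kernel z w)" if "continuous_on UNIV f" for f
    proof -
      have "continuous_on UNIV (\<lambda>w. f w * fock_kernel z w)" by (intro continuous_intros that cK)
      from continuous_indicator_integrable[OF this Ub(1,2)]
      show ?thesis unfolding set_integrable_def by (subst integrable_completion) auto
    qed
    have "(LINT w:U|lebesgue. G w * fock_kernel z w)
        = (LINT w:U|lebesgue. deriv F w * fock_kernel z w - c * (F w * fock_kernel z w))"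
      by (simp add: G_def algebra_simps)
    also have "\<dots> = (LINT w:U|lebesgue. deriv F w * fock_kernel z w) - c * (LINT w:U|lebesgue. F w * fock_kernel z w)"
      unfolding set_integral_mult_right[symmetric]
      by (intro set_integral_diff(2) set_integrable_mult_right int cF)
    finally show ?thesis unfolding eigD[symmetric] eigU[symmetric] by (simp add: G_def algebra_simps)
  qed
  have G0: "G z = 0" for z
  proof (rule ccontr)
    assume Gz: "G z \<noteq> 0"
    \<comment> \<open>If \<open>G\<close> were nonzero, it would be extremal for \<open>S\<close> as well, so its density would be bounded below by a positive constant almost everywhere on \<open>S\<close>, contradicting the zero at the interior point \<open>z0\<close>.\<close>
    obtain g where g: "g \<in> L2" "\<And>z. bargmann g z = of_real l * G z"
      "(L2_norm g)\<^sup>2 = l * (LINT z:U|lebesgue. husimi G z)"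
      using eigenfunction_is_bargmann[OF G Ub(1,2) eigG] by blast
    have hg: "husimi (bargmann g) z = l\<^sup>2 * husimi G z" for z
      using l by (simp add: husimi_def g(2) norm_mult power_mult_distrib)
    have bG: "husimi G z \<le> (L2_norm g)\<^sup>2 / l\<^sup>2" for z
      using husimi_bargmann_le[OF g(1), of z] l unfolding hg by (simp add: pos_le_divide_eq mult.commute)
    have optG: "(LINT z:E|lebesgue. husimi G z) \<le> (LINT z:S|lebesgue. husimi G z)"
      if E: "E \<in> sets_of_measure a" "d_w S E < \<delta>" for E
    proof -
      have Em: "E \<in> lmeasurable" using E a by (simp add: sets_of_measure_iff)
      have I0: "0 \<le> (LINT z:U|lebesgue. husimi G z)"
        unfolding set_lebesgue_integral_def by (rule Bochner_Integration.integral_nonneg) (simp add: indicator_def)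
      have "l\<^sup>2 * (LINT z:E|lebesgue. husimi G z) = (LINT z:E|lebesgue. husimi (bargmann g) z)"
        unfolding hg by (rule set_integral_mult_right[symmetric])
      also have "\<dots> \<le> lambda1 gauss_window E * (L2_norm g)\<^sup>2"
        by (rule husimi_mass_le_lambda1[OF Em g(1)])
      also have "\<dots> \<le> l * (L2_norm g)\<^sup>2"
        using max[OF E] by (intro mult_right_mono) (auto simp: l_def)
      also have "\<dots> = l\<^sup>2 * (LINT z:U|lebesgue. husimi G z)" unfolding g(3) by (simp add: power2_eq_square)
      finally have "(LINT z:E|lebesgue. husimi G z) \<le> (LINT z:U|lebesgue. husimi G z)" using l by simp
      also have "\<dots> = (LINT z:S|lebesgue. husimi G z)"
        by (rule lintSU[symmetric]) (rule borel_measurable_continuous_onI[OF husimi_continuous[OF G]])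
      finally show ?thesis .
    qed
    obtain t' where t': "t' > 0" "S - {z. husimi G z \<ge> t'} \<in> null_sets lebesgue"
      using local_bathtub[OF a S \<delta> husimi_continuous[OF G] husimi_nonneg bG optG husimi_zeros_null[OF G Gz]] by blast
    \<comment> \<open>This open set contains \<open>z0\<close>, so it is not null; but almost every point of \<open>U\<close> lies in \<open>S\<close>, where the density of \<open>G\<close> is at least \<open>t'\<close> almost everywhere.\<close>
    have op: "open (U \<inter> {z. husimi G z < t'})"
      using openU husimi_continuous[OF G] by (intro open_Int open_Collect_less) auto
    have "U \<inter> {z. husimi G z < t'} \<subseteq> (U - S) \<union> (S - {z. husimi G z \<ge> t'})" by auto
    moreover have "(U - S) \<union> (S - {z. husimi G z \<ge> t'}) \<in> null_sets lebesgue"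
      by (rule null_sets.Un[OF US t'(2)])
    moreover have "U \<inter> {z. husimi G z < t'} \<in> sets lebesgue" using op by auto
    ultimately have "U \<inter> {z. husimi G z < t'} \<in> null_sets lebesgue" by (metis null_sets_subset)
    moreover have "z0 \<in> U \<inter> {z. husimi G z < t'}" using z0 Gz0 t' by (simp add: husimi_def)
    ultimately show False using open_not_negligible[OF op] by (auto simp: negligible_iff_null_sets)
  qed
  have F_exp: "F z = F 0 * exp (c * z)" for z
  proof -
    have "((\<lambda>z. F z * exp (- c * z)) has_field_derivative 0) (at z)" for z
    proof -
      have "((\<lambda>z. F z * exp (- c * z)) has_field_derivative
          (F z * (exp (- c * z) * - c) + deriv F z * exp (- c * z))) (at z)"
        using holomorphic_derivI[OF F(1) open_UNIV, of z] by (auto intro!: derivative_eq_intros)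
      moreover have "deriv F z = c * F z" using G0[of z] by (simp add: G_def)
      ultimately show ?thesis by (simp add: algebra_simps)
    qed
    then obtain k where "\<And>z. F z * exp (- c * z) = k"
      using has_field_derivative_zero_constant[OF convex_UNIV, of "\<lambda>z. F z * exp (- c * z)"] by auto
    then have "F z * exp (- c * z) = F 0 * exp (- c * 0)" by metis
    then show ?thesis by (simp add: exp_minus field_simps)
  qed
  obtain b r where r: "r > 0" and ball: "U = ball b r"
    using exponential_superlevel_ball[OF F_exp t] \<open>U \<noteq> {}\<close> unfolding U_def by metis
  have "ennreal (pi * r\<^sup>2) = ennreal a"
    using Ue r unfolding ball by (simp add: emeasure_ball unit_ball_vol_2)
  then have "pi * r\<^sup>2 = a" using a r by simp
  then have "r = sqrt (a / pi)" using r by (auto simp: real_sqrt_unique)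
  then have "(\<lambda>z. z + b) ` ball 0 (sqrt (a / pi)) = U"
    unfolding ball by (simp add: ball_translation[of b 0 r, simplified] add.commute[of _ b])
  then show ?thesis using null by metis
qed

end
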